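(* Let $n\ge 0$ be an integer, let $i\ge 1$, and let $(a_\ell)_{\ell=1}^{i}$, $(b_\ell)_{\ell=1}^{i}$ be finite sequences of complex numbers. (i) If $n\ge 1$, $a_\ell,b_\ell\notin\mathbb{Z}_{<0}$ for all $\ell$, and $\sum_{\ell}a_\ell^{j}=\sum_\ell b_\ell^{j}$ for $j=1,\ldots,n$, then $$\prod_{k=1}^{\infty}\left[\frac{(k+a_1)\cdots(k+a_i)}{(k+b_1)\cdots(k+b_i)}\right]^{\binom{n+k-2}{n-1}}=\frac{\Gamma_n(b_1+1)\cdots\Gamma_n(b_i+1)}{\Gamma_n(a_1+1)\cdots\Gamma_n(a_i+1)}.$$ (ii) If $n\ge 0$, $a_\ell,b_\ell\notin\mathbb{Z}_{\le 0}$ for all $\ell$, and $\sum_\ell a_\ell^{j}=\sum_\ell b_\ell^{j}$ for $j=1,\ldots,n+1$, then $$\prod_{k=0}^{\infty}\left[\frac{(k+a_1)\cdots(k+a_i)}{(k+b_1)\cdots(k+b_i)}\right]^{\binom{n+k}{n}}=\frac{\Gamma_{n+1}(b_1)\cdots\Gamma_{n+1}(b_i)}{\Gamma_{n+1}(a_1)\cdots\Gamma_{n+1}(a_i)}.$$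
   Context: Multiple gamma functions (Vignéras): $\Gamma_m$, $m\ge 1$, are meromorphic functions on $\mathbb{C}$, positive on $(0,\infty)$, without zeros and with poles exactly at the non-positive integers, determined by $\Gamma_1=\Gamma$, $\Gamma_{m}(1)=1$, $\Gamma_{m+1}(z+1)=\Gamma_{m+1}(z)/\Gamma_m(z)$, together with the log-convexity condition $(-1)^{m+1}\frac{d^{m+1}}{dx^{m+1}}\log\Gamma_m(x)\ge 0$ for $x>0$. In particular $\Gamma_2=1/G$ with $G$ the Barnes $G$-function. An infinite product identity asserts convergence of the partial products (over the index $k$, each block with its exponent being one factor) to the stated value. *)

theory Defs
  imports "HOL-Complex_Analysis.Complex_Analysis"
begin

text \<open>
  Vigneras' conditions on the \<open>m\<close>-th multiple gamma function \<open>f\<close>, given the previous one \<open>g\<close>.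
  As for the library's \<^const>\<open>Gamma\<close>, the junk value at a pole is \<open>0\<close>; this is part of
  \<^const>\<open>nicely_meromorphic_on\<close> and makes \<open>f\<close> unique as a total function. The functional
  equation and the absence of zeros are therefore only required off the poles.
\<close>

definition is_multiple_Gamma ::
    "nat \<Rightarrow> (complex \<Rightarrow> complex) \<Rightarrow> (complex \<Rightarrow> complex) \<Rightarrow> bool" where
  "is_multiple_Gamma m g f \<longleftrightarrow>
     f nicely_meromorphic_on UNIV \<and>
     (\<forall>x::real. x > 0 \<longrightarrow> f (of_real x) \<in> \<real> \<and> Re (f (of_real x)) > 0) \<and>
     (\<forall>z. is_pole f z \<longleftrightarrow> z \<in> \<int>\<^sub>\<le>\<^sub>0) \<and>
     (\<forall>z. z \<notin> \<int>\<^sub>\<le>\<^sub>0 \<longrightarrow> f z \<noteq> 0) \<and>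
     f 1 = 1 \<and>
     (\<forall>z. z \<notin> \<int>\<^sub>\<le>\<^sub>0 \<longrightarrow> f (z + 1) = f z / g z) \<and>
     (\<forall>x::real. x > 0 \<longrightarrow>
        (-1) ^ (m + 1) * (deriv ^^ (m + 1)) (\<lambda>t::real. ln (Re (f (of_real t)))) x \<ge> 0)"

text \<open>
  The functions \<open>\<Gamma>\<^sub>m\<close> for \<open>m \<ge> 1\<close>. Index \<open>0\<close> is outside the range of the definition; it is
  given the value \<open>1/z\<close>, for which the functional equation of \<open>\<Gamma>\<^sub>1\<close> has the same form.
\<close>

fun multiple_Gamma :: "nat \<Rightarrow> complex \<Rightarrow> complex" where
  "multiple_Gamma 0 = (\<lambda>z. 1 / z)"
| "multiple_Gamma (Suc 0) = Gamma"
| "multiple_Gamma (Suc (Suc m)) =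
     (THE f. is_multiple_Gamma (Suc (Suc m)) (multiple_Gamma (Suc m)) f)"

end

theory Submission
  imports Defs
begin

text \<open>
  Write \<open>c k = (n + k choose n)\<close>. The theorem is immediate once the following representation is known:
  there are polynomials \<open>P N\<close> of degree at most \<open>n + 1\<close> such that, as \<open>N\<close> tends to infinity,
  \<open>exp (P N z) * (\<Prod>k<N. (k + z) ^ c k)\<close> converges to \<open>1 / \<Gamma>\<^sub>n\<^sub>+\<^sub>1 z\<close> for all \<open>z\<close>. Indeed, since the power sums
  of \<open>a\<close> and \<open>b\<close> agree up to the order \<open>n + 1\<close>, the sums of \<open>P N (a l)\<close> and of \<open>P N (b l)\<close> over \<open>l\<close> are equal,
  so that the exponentials cancel in the quotient of the products for \<open>a\<close> and for \<open>b\<close>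
  (lemma \<open>product_formula\<close>). The formula with exponents \<open>n + k - 2 choose n - 1\<close> is the other one for
  \<open>n - 1\<close> and the sequences shifted by \<open>1\<close>.

  For the representation, let \<open>A\<^sub>n\<close> be the entire function given by the Weierstrass product with zeros of
  order \<open>c k\<close> at \<open>-k\<close>, where the logarithm of every factor is compensated by its Taylor polynomial of
  degree \<open>n + 1\<close>. Because of Pascal's rule, \<open>A\<^sub>n\<^sub>+\<^sub>1 z\<close> and \<open>A\<^sub>n z * A\<^sub>n\<^sub>+\<^sub>1 (z + 1)\<close> differ only by the exponential of a
  limit of polynomials of degree at most \<open>n + 1\<close>, hence of a polynomial
  (\<open>weierstrass_log_functional_equation\<close>). Solving a difference equation for polynomials gives \<open>Q\<^sub>n\<close> of degree
  at most \<open>n + 1\<close> such that the functions \<open>1 / (exp Q\<^sub>n * A\<^sub>n)\<close> satisfy the functional equations exactly,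
  starting from the Weierstrass product of the Gamma function for \<open>n = 0\<close>. The derivative of order \<open>n + 2\<close> of
  their logarithms is an explicit series with terms of one sign, which is the required log-convexity.

  The multiple Gamma functions are given by a definite description, so they can only be identified
  with these functions by uniqueness. This is a Bohr-Mollerup argument for higher derivatives
  (\<open>higher_Bohr_Mollerup_uniqueness\<close>): two solutions differ, in logarithms and on the positive axis, by a
  periodic function. Log-convexity bounds the oscillation of its derivative of the critical order by the
  corresponding derivative of the logarithm of the previous Gamma function, which tends to \<open>0\<close> at infinity.
  So this derivative is constant, and the periodic function itself is constant.
\<close>

section \<open>Estimates for the logarithmic remainders\<close>

text \<open>
  The Taylor polynomial of \<open>ln (1 + w)\<close> of degree \<open>d\<close>. Its term for \<open>j = 0\<close> is \<open>0\<close>, since \<open>x / 0 = 0\<close>.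
  It is polymorphic because both its complex values and its values as a real polynomial are needed.
\<close>

definition ln_taylor :: "nat \<Rightarrow> 'a::real_normed_field \<Rightarrow> 'a" where
  "ln_taylor d w = (\<Sum>j\<le>d. (-1) ^ Suc j / of_nat j * w ^ j)"

lemma of_real_ln_taylor: "of_real (ln_taylor d x) = ln_taylor d (of_real x)"
  by (simp add: ln_taylor_def)

lemma norm_Ln_minus_taylor_le:
  fixes w :: complex
  assumes "norm w \<le> 1 / 2"
  shows "norm (Ln (1 + w) - ln_taylor d w) \<le> 2 * norm w ^ Suc d"
proof -
  let ?f = "\<lambda>j. (-1) ^ Suc j / of_nat j * w ^ j"
  let ?g = "\<lambda>j. norm w ^ Suc d * (1 / 2) ^ j :: real"
  have "(\<lambda>j. ?f (j + Suc d)) sums (Ln (1 + w) - (\<Sum>j<Suc d. ?f j))"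
    using Ln_series[of w] assms by (intro sums_split_initial_segment) auto
  hence s: "(\<lambda>j. ?f (j + Suc d)) sums (Ln (1 + w) - ln_taylor d w)"
    by (simp only: ln_taylor_def lessThan_Suc_atMost)
  have g: "?g sums (norm w ^ Suc d * 2)"
    using sums_mult[OF geometric_sums[of "1/2::real"], of "norm w ^ Suc d"] by simp
  have le: "norm (?f (j + Suc d)) \<le> ?g j" for j
  proof -
    have "norm (?f (j + Suc d)) = norm w ^ (j + Suc d) / real (j + Suc d)"
      unfolding norm_mult norm_divide norm_power norm_of_nat by simp
    also have "\<dots> \<le> norm w ^ (j + Suc d) / 1"
      by (intro divide_left_mono) auto
    also have "\<dots> = norm w ^ Suc d * norm w ^ j" by (simp add: power_add)
    also have "\<dots> \<le> ?g j"
      using assms by (intro mult_left_mono power_mono) auto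
    finally show ?thesis .
  qed
  have "norm (\<Sum>j. ?f (j + Suc d)) \<le> (\<Sum>j. ?g j)"
    by (rule norm_suminf_le[OF le sums_summable[OF g]])
  thus ?thesis using s g by (simp add: sums_iff mult.commute)
qed

text \<open>
  The exponents grow like \<open>k ^ n\<close>. This decides the degree \<open>n + 1\<close> up to which the logarithm of each
  factor must be compensated: the remaining terms are then of order \<open>k ^ n / k ^ (n + 2)\<close>.
\<close>

lemma choose_le_power: "(n + k) choose n \<le> (k + 1) ^ n"
proof (induction n)
  case (Suc n)
  have "Suc n * ((Suc n + k) choose Suc n) = (n + k + 1) * ((n + k) choose n)"
    using Suc_times_binomial_eq[of "n + k" n] by (simp add: mult.commute)
  also have "\<dots> \<le> (Suc n * (k + 1)) * (k + 1) ^ n"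
    by (intro mult_mono Suc.IH) auto
  also have "\<dots> = Suc n * (k + 1) ^ Suc n" by (simp add: algebra_simps)
  finally show ?case by (simp only: mult_le_cancel1) 
qed simp

text \<open>
  The logarithm of the \<open>k\<close>-th Weierstrass factor
  \<open>((1 + z / k) * exp (- T (z / k))) ^ (n + k choose n)\<close> with \<open>T\<close> the Taylor polynomial of degree
  \<open>n + 1\<close>.
\<close>

definition log_remainder :: "nat \<Rightarrow> nat \<Rightarrow> complex \<Rightarrow> complex" where
  "log_remainder n k z = of_nat ((n + k) choose n) *
     (Ln (1 + z / of_nat k) - ln_taylor (n + 1) (z / of_nat k))"

lemma norm_log_remainder_le:
  assumes "k \<ge> 1" "2 * norm z \<le> real k" "norm z \<le> R"
  shows "norm (log_remainder n k z) \<le> 2 ^ (n + 1) * R ^ (n + 2) / real k ^ 2"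
proof -
  have R: "R \<ge> 0" using assms(3) norm_ge_zero order_trans by blast
  have "norm (z / of_nat k) \<le> 1 / 2"
    using assms by (simp add: norm_divide field_simps)
  hence "norm (Ln (1 + z / of_nat k) - ln_taylor (n + 1) (z / of_nat k))
           \<le> 2 * norm (z / of_nat k) ^ Suc (n + 1)"
    by (rule norm_Ln_minus_taylor_le)
  also have "\<dots> \<le> 2 * (R / real k) ^ Suc (n + 1)"
    using assms by (intro mult_left_mono power_mono) (auto simp: norm_divide divide_right_mono)
  finally have 1: "norm (Ln (1 + z / of_nat k) - ln_taylor (n + 1) (z / of_nat k))
           \<le> 2 * (R / real k) ^ (n + 2)" by simp
  have "real ((n + k) choose n) \<le> real ((k + 1) ^ n)"
    using choose_le_power[of n k] by (intro of_nat_mono)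
  also have "\<dots> \<le> (2 * real k) ^ n"
    unfolding of_nat_power using assms by (intro power_mono) auto
  finally have 2: "real ((n + k) choose n) \<le> (2 * real k) ^ n" .
  have "norm (log_remainder n k z) \<le> (2 * real k) ^ n * (2 * (R / real k) ^ (n + 2))"
    unfolding log_remainder_def norm_mult norm_of_nat using 1 2 R
    by (intro mult_mono) auto
  also have "\<dots> = 2 ^ (n + 1) * R ^ (n + 2) / real k ^ 2"
    using assms by (simp add: field_simps power_mult_distrib power_add power2_eq_square)
  finally show ?thesis .
qed

lemma log_remainder_holomorphic:
  assumes "k \<ge> 1" "2 * R \<le> real k"
  shows "log_remainder n k holomorphic_on ball 0 R"
proof -
  have "1 + z / of_nat k \<notin> \<real>\<^sub>\<le>\<^sub>0" if "z \<in> ball 0 R" for z :: complex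
  proof -
    define w where "w = z / of_nat k"
    have "norm w < 1"
      using that assms by (simp add: w_def norm_divide field_simps)
    hence "\<bar>Re w\<bar> < 1" using abs_Re_le_cmod order_le_less_trans by blast
    thus ?thesis unfolding w_def [symmetric] by (auto simp: complex_nonpos_Reals_iff)
  qed
  thus ?thesis using assms unfolding log_remainder_def[abs_def] ln_taylor_def
    by (intro holomorphic_intros) auto
qed

text \<open>
  On the disc of radius \<open>R\<close>, the estimate of the Taylor error holds for the factors with \<open>k \<ge> 2 * R\<close>,
  and for these the Weierstrass M-test applies. The finitely many factors before \<open>K\<close> are kept apart.
\<close>

lemma uniform_limit_log_remainder:
  assumes "K \<ge> 1" "2 * R \<le> real K"
  obtains V where "V holomorphic_on ball 0 R"
    and "uniform_limit (ball 0 R) (\<lambda>N z. \<Sum>k\<in>{K..<N}. log_remainder n k z) V sequentially"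
proof -
  let ?f = "\<lambda>k z. if K \<le> k then log_remainder n k z else 0"
  let ?M = "\<lambda>k. (2 ^ (n + 1) * \<bar>R\<bar> ^ (n + 2)) * inverse (real k ^ 2)"
  have sM: "summable ?M"
    by (intro summable_mult inverse_power_summable) auto
  have bound: "norm (?f k z) \<le> ?M k" if z: "z \<in> ball 0 R" for k z
  proof (cases "K \<le> k")
    case True
    have "norm (log_remainder n k z) \<le> 2 ^ (n + 1) * \<bar>R\<bar> ^ (n + 2) / real k ^ 2"
      using z True assms by (intro norm_log_remainder_le) auto
    thus ?thesis using True by (simp add: field_simps)
  qed auto
  have u: "uniform_limit (ball 0 R) (\<lambda>N z. \<Sum>k<N. ?f k z) (\<lambda>z. \<Sum>k. ?f k z) sequentially"
    by (rule Weierstrass_m_test[OF bound sM])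
  have eq: "(\<Sum>k<N. ?f k z) = (\<Sum>k\<in>{K..<N}. log_remainder n k z)" for N z
  proof -
    have "(\<Sum>k<N. ?f k z) = (\<Sum>k\<in>{k. k < N \<and> K \<le> k}. log_remainder n k z)"
      by (subst sum.inter_filter[symmetric]) (auto simp: lessThan_def)
    also have "{k. k < N \<and> K \<le> k} = {K..<N}" by auto
    finally show ?thesis .
  qed
  have hol: "(\<lambda>z. \<Sum>k\<in>{K..<N}. log_remainder n k z) holomorphic_on ball 0 R" for N
    using assms by (intro holomorphic_intros log_remainder_holomorphic) auto
  let ?V = "\<lambda>z. \<Sum>k. ?f k z"
  have u': "uniform_limit (ball 0 R) (\<lambda>N z. \<Sum>k\<in>{K..<N}. log_remainder n k z) ?V sequentially"
    using u by (simp only: eq)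
  have "?V holomorphic_on ball 0 R"
  proof (rule holomorphic_uniform_sequence[OF open_ball hol])
    fix x :: complex assume "x \<in> ball 0 R"
    then obtain d where "d > 0" "cball x d \<subseteq> ball 0 R"
      using open_contains_cball[of "ball 0 R"] open_ball by blast
    thus "\<exists>d>0. cball x d \<subseteq> ball 0 R \<and>
            uniform_limit (cball x d) (\<lambda>N z. \<Sum>k\<in>{K..<N}. log_remainder n k z) ?V sequentially"
      using uniform_limit_on_subset[OF u'] by blast
  qed
  with u' that show ?thesis by blast
qed

section \<open>Weierstrass products with binomial exponents\<close>

text \<open>
  The polynomial whose exponential normalises the partial product. The summand \<open>ln k\<close> replaces
  the factor \<open>k + z\<close> by \<open>1 + z / k\<close>, the Taylor polynomial makes the product converge. The
  product formula works because this is a polynomial in \<open>z\<close> of degree at most \<open>n + 1\<close>.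
\<close>

definition weierstrass_correction :: "nat \<Rightarrow> nat \<Rightarrow> 'a::real_normed_field \<Rightarrow> 'a" where
  "weierstrass_correction n N z = (\<Sum>k\<in>{1..<N}. of_nat ((n + k) choose n) *
     (of_real (ln (real k)) + ln_taylor (n + 1) (z / of_nat k)))"

definition partial_product :: "nat \<Rightarrow> nat \<Rightarrow> complex \<Rightarrow> complex" where
  "partial_product n N z =
     exp (- weierstrass_correction n N z) * (\<Prod>k<N. (of_nat k + z) ^ ((n + k) choose n))"

definition partial_log :: "nat \<Rightarrow> nat \<Rightarrow> complex \<Rightarrow> complex" where
  "partial_log n N z =
     (\<Sum>k<N. of_nat ((n + k) choose n) * Ln (of_nat k + z)) - weierstrass_correction n N z"

lemma partial_product_split:
  assumes "K \<ge> 1" "2 * R \<le> real K" "z \<in> ball 0 R" "K \<le> N"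
  shows "partial_product n N z = partial_product n K z * exp (\<Sum>k\<in>{K..<N}. log_remainder n k z)"
  using assms(4)
proof (induction N rule: dec_induct)
  case (step N)
  let ?c = "(n + N) choose n" and ?w = "z / of_nat N"
  have N: "N > 0" using step assms by auto
  have "norm ?w < 1" using assms step by (simp add: norm_divide field_simps)
  hence nz: "1 + ?w \<noteq> 0"
    by (metis add_eq_0_iff norm_minus_cancel norm_one order_less_irrefl)
  have e: "exp (complex_of_real (ln (real N))) = of_nat N"
    using N by (simp add: exp_of_real)
  have "of_nat N + z = of_nat N * (1 + ?w)" using N by (simp add: field_simps)
  also have "\<dots> = exp (of_real (ln (real N)) + Ln (1 + ?w))"
    using nz by (simp add: exp_add e)
  finally have fac: "(of_nat N + z) ^ ?c = exp (of_nat ?c * (of_real (ln (real N)) + Ln (1 + ?w)))"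
    by (simp add: exp_of_nat_mult)
  have corr: "weierstrass_correction n (Suc N) z = weierstrass_correction n N z +
      of_nat ?c * (of_real (ln (real N)) + ln_taylor (n + 1) ?w)"
    using N by (simp add: weierstrass_correction_def)
  have "partial_product n (Suc N) z = partial_product n N z * exp (log_remainder n N z)"
    unfolding partial_product_def corr log_remainder_def prod.lessThan_Suc fac
    by (simp add: exp_add exp_diff exp_minus ring_distribs field_simps)
  also have "\<dots> = partial_product n K z * exp (\<Sum>k\<in>{K..<Suc N}. log_remainder n k z)"
    using step by (simp add: exp_add)
  finally show ?case .
qed auto

lemma partial_log_split:
  assumes "K \<ge> 1" "Re z > 0" "K \<le> N"
  shows "partial_log n N z = partial_log n K z + (\<Sum>k\<in>{K..<N}. log_remainder n k z)"
  using assms(3)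
proof (induction N rule: dec_induct)
  case (step N)
  let ?c = "(n + N) choose n" and ?w = "z / of_nat N"
  have N: "N > 0" using step assms by auto
  have nz: "1 + ?w \<noteq> 0"
  proof
    assume "1 + ?w = 0"
    hence "z = - of_nat N" using N by (simp add: field_simps eq_neg_iff_add_eq_0)
    thus False using assms N by simp
  qed
  have "of_nat N + z = of_real (real N) * (1 + ?w)" using N by (simp add: field_simps)
  also have "Ln \<dots> = of_real (ln (real N)) + Ln (1 + ?w)"
    using nz N Ln_times_of_real[of "real N" "1 + ?w"] by (simp add: Ln_of_real)
  finally have fac: "Ln (of_nat N + z) = of_real (ln (real N)) + Ln (1 + ?w)" .
  have "partial_log n (Suc N) z = partial_log n N z + log_remainder n N z"
    using N unfolding partial_log_def log_remainder_def weierstrass_correction_def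
      sum.lessThan_Suc fac
    by (simp add: algebra_simps)
  thus ?case using step by simp
qed auto

lemma exp_partial_log:
  assumes "Re z > 0"
  shows "exp (partial_log n N z) = partial_product n N z"
proof -
  have "of_nat k + z \<noteq> 0" for k using assms by (auto simp: complex_eq_iff)
  hence "exp (of_nat m * Ln (of_nat k + z)) = (of_nat k + z) ^ m" for k m :: nat
    by (simp add: exp_of_nat_mult)
  thus ?thesis
    unfolding partial_log_def partial_product_def
    by (simp add: exp_diff exp_minus exp_sum divide_inverse)
qed

definition weierstrass_product :: "nat \<Rightarrow> complex \<Rightarrow> complex" where
  "weierstrass_product n z = lim (\<lambda>N. partial_product n N z)"

definition weierstrass_log :: "nat \<Rightarrow> complex \<Rightarrow> complex" where
  "weierstrass_log n z = lim (\<lambda>N. partial_log n N z)"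

lemma weierstrass_correction_holomorphic [holomorphic_intros]:
  "weierstrass_correction n N holomorphic_on A"
  unfolding weierstrass_correction_def[abs_def] ln_taylor_def
  by (intro holomorphic_intros) auto

lemma partial_product_holomorphic: "partial_product n N holomorphic_on A"
  unfolding partial_product_def[abs_def] by (intro holomorphic_intros)

lemma partial_log_holomorphic: "partial_log n N holomorphic_on {z. Re z > 0}"
  unfolding partial_log_def[abs_def]
  by (intro holomorphic_intros) (auto simp: complex_nonpos_Reals_iff)

lemma partial_product_eq_0_iff: "partial_product n N z = 0 \<longleftrightarrow> (\<exists>k<N. z = - of_nat k)"
proof -
  have "(n + k) choose n > 0" for k by simp
  thus ?thesis unfolding partial_product_def
    by (auto simp: add_eq_0_iff2 add.commute)
qed

text \<open>
  On a disc, both limits are a finite piece modified by one and the same holomorphic tail \<open>V\<close>.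
  Holomorphy and the zero set of the product, and the convergence of the logarithms, can be read off
  from this.
\<close>

lemma weierstrass_product_local:
  obtains K V where "K \<ge> 1" "2 * R \<le> real K" "V holomorphic_on ball 0 R"
    "\<And>z. z \<in> ball 0 R \<Longrightarrow> (\<lambda>N. partial_product n N z) \<longlonglongrightarrow> partial_product n K z * exp (V z)"
    "uniform_limit ({z. Re z > 0} \<inter> ball 0 R) (partial_log n) (\<lambda>z. partial_log n K z + V z) sequentially"
proof -
  obtain K0 where K0: "2 * R \<le> real K0" using real_arch_simple by blast
  define K where "K = Suc K0"
  have K: "K \<ge> 1" "2 * R \<le> real K" using K0 by (auto simp: K_def)
  obtain V where V: "V holomorphic_on ball 0 R"
    "uniform_limit (ball 0 R) (\<lambda>N z. \<Sum>k\<in>{K..<N}. log_remainder n k z) V sequentially"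
    using uniform_limit_log_remainder[OF K] by blast
  have 1: "(\<lambda>N. partial_product n N z) \<longlonglongrightarrow> partial_product n K z * exp (V z)" if z: "z \<in> ball 0 R" for z
  proof -
    have "(\<lambda>N. partial_product n K z * exp (\<Sum>k\<in>{K..<N}. log_remainder n k z))
            \<longlonglongrightarrow> partial_product n K z * exp (V z)"
      using tendsto_uniform_limitI[OF V(2) z] by (intro tendsto_intros)
    moreover have "\<forall>\<^sub>F N in sequentially. partial_product n K z * exp (\<Sum>k\<in>{K..<N}. log_remainder n k z)
                     = partial_product n N z"
      using eventually_ge_at_top[of K]
      by eventually_elim (rule partial_product_split[OF K z, symmetric])
    ultimately show ?thesis by (rule Lim_transform_eventually)
  qed
  have 2: "uniform_limit ({z. Re z > 0} \<inter> ball 0 R) 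
     (\<lambda>N z. partial_log n K z + (\<Sum>k\<in>{K..<N}. log_remainder n k z)) (\<lambda>z. partial_log n K z + V z) sequentially"
    by (intro uniform_limit_intros uniform_limit_on_subset[OF V(2)]) auto
  have "uniform_limit ({z. Re z > 0} \<inter> ball 0 R) (partial_log n) (\<lambda>z. partial_log n K z + V z) sequentially"
    using 2
  proof (rule uniform_limit_cong[THEN iffD1, rotated -1])
    show "\<forall>\<^sub>F N in sequentially. \<forall>z\<in>{z. 0 < Re z} \<inter> ball 0 R.
       partial_log n K z + (\<Sum>k\<in>{K..<N}. log_remainder n k z) = partial_log n N z"
      using eventually_ge_at_top[of K]
      by eventually_elim (auto intro: partial_log_split[OF K(1), symmetric])
  qed auto
  with 1 K V that show ?thesis by blast
qed

lemma partial_product_tendsto: "(\<lambda>N. partial_product n N z) \<longlonglongrightarrow> weierstrass_product n z"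
proof -
  obtain K V where "\<And>z'. z' \<in> ball 0 (norm z + 1) \<Longrightarrow> (\<lambda>N. partial_product n N z') \<longlonglongrightarrow> partial_product n K z' * exp (V z')"
    using weierstrass_product_local[where R = "norm z + 1" and n = n] by metis
  from this[of z] show ?thesis unfolding weierstrass_product_def
    by (simp add: limI)
qed

lemma partial_log_uniform_limit:
  "uniform_limit ({z. Re z > 0} \<inter> ball 0 R) (partial_log n) (weierstrass_log n) sequentially"
proof -
  obtain K V where u:
    "uniform_limit ({z. Re z > 0} \<inter> ball 0 R) (partial_log n) (\<lambda>z. partial_log n K z + V z) sequentially"
    using weierstrass_product_local[where R = R and n = n] by metis
  have "weierstrass_log n z = partial_log n K z + V z" if "z \<in> {z. Re z > 0} \<inter> ball 0 R" for z
    unfolding weierstrass_log_def using tendsto_uniform_limitI[OF u that] by (rule limI)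
  thus ?thesis using u by (subst uniform_limit_cong') auto
qed

lemma partial_log_tendsto:
  assumes "Re z > 0" shows "(\<lambda>N. partial_log n N z) \<longlonglongrightarrow> weierstrass_log n z"
  using tendsto_uniform_limitI[OF partial_log_uniform_limit[where R = "norm z + 1" and n = n], of z] assms by simp

lemma exp_weierstrass_log:
  assumes "Re z > 0" shows "exp (weierstrass_log n z) = weierstrass_product n z"
proof (rule LIMSEQ_unique)
  show "(\<lambda>N. partial_product n N z) \<longlonglongrightarrow> weierstrass_product n z"
    by (rule partial_product_tendsto)
  show "(\<lambda>N. partial_product n N z) \<longlonglongrightarrow> exp (weierstrass_log n z)"
    using tendsto_exp[OF partial_log_tendsto[OF assms, of n]] exp_partial_log[OF assms] by simp
qed

lemma weierstrass_log_holomorphic: "weierstrass_log n holomorphic_on {z. Re z > 0}"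
proof (rule holomorphic_uniform_sequence[OF open_halfspace_Re_gt partial_log_holomorphic])
  fix x :: complex assume "x \<in> {z. Re z > 0}"
  moreover have "open ({z::complex. Re z > 0} \<inter> ball 0 (norm x + 1))"
    by (intro open_Int open_halfspace_Re_gt open_ball)
  ultimately obtain d where "d > 0" "cball x d \<subseteq> {z. Re z > 0} \<inter> ball 0 (norm x + 1)"
    unfolding open_contains_cball by force
  thus "\<exists>d>0. cball x d \<subseteq> {z. Re z > 0} \<and> uniform_limit (cball x d) (partial_log n) (weierstrass_log n) sequentially"
    using uniform_limit_on_subset[OF partial_log_uniform_limit] by blast
qed

lemma weierstrass_product_holomorphic: "weierstrass_product n holomorphic_on UNIV"
proof -
  have "weierstrass_product n field_differentiable at z" for z
  proof -
    obtain K V where KV: "V holomorphic_on ball 0 (norm z + 1)"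
    "\<And>w. w \<in> ball 0 (norm z + 1) \<Longrightarrow> (\<lambda>N. partial_product n N w) \<longlonglongrightarrow> partial_product n K w * exp (V w)"
      using weierstrass_product_local[where R = "norm z + 1" and n = n] by metis
    have "(\<lambda>w. partial_product n K w * exp (V w)) holomorphic_on ball 0 (norm z + 1)"
      by (intro holomorphic_intros partial_product_holomorphic KV(1))
    hence "weierstrass_product n holomorphic_on ball 0 (norm z + 1)"
      by (rule holomorphic_transform)
         (use KV(2) in \<open>auto simp: weierstrass_product_def intro!: limI[symmetric]\<close>)
    thus ?thesis by (auto simp: holomorphic_on_open field_differentiable_def)
  qed
  thus ?thesis by (auto simp: holomorphic_on_def field_differentiable_at_within)
qed

lemma weierstrass_product_eq_0_iff: "weierstrass_product n z = 0 \<longleftrightarrow> z \<in> \<int>\<^sub>\<le>\<^sub>0"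
proof -
  obtain K V where KV: "K \<ge> 1" "2 * (norm z + 1) \<le> real K"
    "\<And>w. w \<in> ball 0 (norm z + 1) \<Longrightarrow> (\<lambda>N. partial_product n N w) \<longlonglongrightarrow> partial_product n K w * exp (V w)"
    using weierstrass_product_local[where R = "norm z + 1" and n = n] by metis
  have "weierstrass_product n z = partial_product n K z * exp (V z)"
    unfolding weierstrass_product_def by (intro limI KV) auto
  hence "weierstrass_product n z = 0 \<longleftrightarrow> (\<exists>k<K. z = - of_nat k)"
    by (simp add: partial_product_eq_0_iff)
  also have "\<dots> \<longleftrightarrow> z \<in> \<int>\<^sub>\<le>\<^sub>0"
  proof
    assume "z \<in> \<int>\<^sub>\<le>\<^sub>0"
    then obtain k where k: "z = - of_nat k" by (elim nonpos_Ints_cases')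
    hence "k < K" using KV(2) by simp
    with k show "\<exists>k<K. z = - of_nat k" by blast
  qed auto
  finally show ?thesis .
qed

section \<open>Polynomials, pointwise limits and difference equations\<close>

text \<open>
  By induction on the degree: dividing out the root \<open>a\<close> of \<open>p N - p N a\<close> lowers the degree and
  preserves pointwise convergence away from \<open>a\<close>.
\<close>

lemma polynomial_pointwise_limit:
  fixes p :: "nat \<Rightarrow> real poly" and f :: "real \<Rightarrow> real"
  assumes "\<And>N. degree (p N) \<le> d" "infinite A" "\<And>x. x \<in> A \<Longrightarrow> (\<lambda>N. poly (p N) x) \<longlonglongrightarrow> f x"
  shows "\<exists>q. degree q \<le> d \<and> (\<forall>x\<in>A. poly q x = f x)"
  using assms
proof (induction d arbitrary: p f A)
  case 0
  obtain a where a: "a \<in> A" using infinite_imp_nonempty[OF "0.prems"(2)] by blast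
  have const: "poly (p N) x = poly (p N) a" for N x
  proof -
    have "degree (p N) = 0" using "0.prems"(1)[of N] by simp
    then obtain c where "p N = [:c:]" by (rule degree_eq_zeroE)
    thus ?thesis by simp
  qed
  have "f x = f a" if x: "x \<in> A" for x
  proof (rule LIMSEQ_unique)
    show "(\<lambda>N. poly (p N) x) \<longlonglongrightarrow> f x" by (rule "0.prems"(3)[OF x])
    show "(\<lambda>N. poly (p N) x) \<longlonglongrightarrow> f a"
      unfolding const[of _ x] by (rule "0.prems"(3)[OF a])
  qed
  thus ?case by (intro exI[of _ "[:f a:]"]) auto
next
  case (Suc d)
  obtain a where a: "a \<in> A" using infinite_imp_nonempty[OF Suc.prems(2)] by blast
  define s where "s N = synthetic_div (p N) a" for N
  define g where "g x = (f x - f a) / (x - a)" for x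
  have "\<exists>q. degree q \<le> d \<and> (\<forall>x\<in>A - {a}. poly q x = g x)"
  proof (rule Suc.IH)
    show "degree (s N) \<le> d" for N
      using Suc.prems(1)[of N] by (simp add: s_def degree_synthetic_div)
    show "infinite (A - {a})" using Suc.prems(2) by simp
  next
    fix x assume x: "x \<in> A - {a}"
    have "poly (s N) x = (poly (p N) x - poly (p N) a) / (x - a)" for N
    proof -
      have "poly (p N) x = poly ([:- a, 1:] * s N + [:poly (p N) a:]) x"
        unfolding s_def synthetic_div_correct' ..
      thus ?thesis using x by (simp add: field_simps)
    qed
    moreover have "(\<lambda>N. (poly (p N) x - poly (p N) a) / (x - a)) \<longlonglongrightarrow> g x"
      unfolding g_def using x a by (intro tendsto_intros Suc.prems(3)) auto
    ultimately show "(\<lambda>N. poly (s N) x) \<longlonglongrightarrow> g x" by simp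
  qed
  then obtain q where q: "degree q \<le> d" "\<And>x. x \<in> A - {a} \<Longrightarrow> poly q x = g x" by blast
  define r where "r = [:- a, 1:] * q + [:f a:]"
  have "degree ([:- a, 1:] * q) \<le> Suc d"
    using degree_mult_le[of "[:- a, 1:]" q] q(1) by simp
  hence "degree r \<le> Suc d" unfolding r_def by (intro degree_add_le) auto
  moreover have "poly r x = f x" if "x \<in> A" for x
    using q(2)[of x] that by (cases "x = a") (auto simp: r_def g_def field_simps)
  ultimately show ?case by blast
qed

text \<open>
  The leading coefficients cancel.
\<close>

lemma degree_forward_difference_le:
  fixes p :: "'a::idom poly"
  assumes "degree p \<le> Suc d"
  shows "degree (pcompose p [:1, 1:] - p) \<le> d"
proof -
  let ?q = "pcompose p [:1, 1:] - p"
  have deg: "degree (pcompose p [:1, 1:]) = degree p" by (simp add: degree_pcompose)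
  have "coeff (pcompose p [:1, 1:]) (Suc d) = coeff p (Suc d)"
  proof (cases "degree p = Suc d")
    case True
    thus ?thesis using lead_coeff_comp[of "[:1, 1:]" p] deg by simp
  next
    case False
    thus ?thesis using assms deg by (simp add: coeff_eq_0)
  qed
  hence "coeff ?q (Suc d) = 0" by simp
  moreover have "degree ?q \<le> Suc d"
    using degree_diff_le[of "pcompose p [:1, 1:]" "Suc d" p] deg assms by simp
  ultimately show ?thesis
    by (metis le_SucE leading_coeff_0_iff degree_0 le0)
qed

text \<open>
  The forward difference of \<open>x ^ (d + 2) / (d + 2)\<close> has leading term \<open>x ^ (d + 1)\<close>, so the leading term
  of \<open>p\<close> can be removed, and the rest is an induction on the degree.
\<close>

lemma polynomial_antidifference:
  fixes p :: "'a::field_char_0 poly"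
  assumes "degree p \<le> d"
  shows "\<exists>q. degree q \<le> Suc d \<and> pcompose q [:1, 1:] - q = p"
  using assms
proof (induction d arbitrary: p)
  case 0
  hence "degree p = 0" by simp
  then obtain a where "p = [:a:]" by (rule degree_eq_zeroE)
  thus ?case by (intro exI[of _ "[:0, a:]"]) (auto simp: pcompose_pCons)
next
  case (Suc d)
  define m where "m = monom (coeff p (Suc d) / of_nat (d + 2)) (d + 2)"
  define r where "r = p - (pcompose m [:1, 1:] - m)"
  have deg_m: "degree m \<le> Suc (Suc d)"
    unfolding m_def by (rule order_trans[OF degree_monom_le]) simp
  have comp_power: "pcompose ([:0, 1:] ^ k) [:1, 1:] = [:1, 1 :: 'a:] ^ k" for k
    by (induction k) (simp_all add: pcompose_1 pcompose_mult pcompose_pCons)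
  have "pcompose m [:1, 1:] = smult (coeff p (Suc d) / of_nat (d + 2)) ([:1, 1:] ^ (d + 2))"
    by (simp only: m_def monom_altdef pcompose_smult comp_power)
  moreover have "coeff ([:1, 1:] ^ (d + 2) :: 'a poly) (Suc d) = of_nat (d + 2)"
    by (subst coeff_linear_poly_power) auto
  ultimately have "coeff (pcompose m [:1, 1:]) (Suc d) = coeff p (Suc d)"
    by (simp del: of_nat_add of_nat_Suc)
  hence "coeff r (Suc d) = 0" by (simp add: r_def m_def)
  moreover have "degree r \<le> Suc d" unfolding r_def
    by (intro degree_diff_le degree_forward_difference_le Suc.prems deg_m)
  ultimately have "degree r \<le> d"
    by (metis le_SucE leading_coeff_0_iff degree_0 le0)
  then obtain q where q: "degree q \<le> Suc d" "pcompose q [:1, 1:] - q = r"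
    using Suc.IH by blast
  have "degree (q + m) \<le> Suc (Suc d)" using q(1) deg_m by (intro degree_add_le) auto
  moreover have "pcompose (q + m) [:1, 1:] - (q + m) = p"
    using q(2) by (simp add: pcompose_add r_def algebra_simps)
  ultimately show ?case by blast
qed

lemma ln_taylor_polynomial:
  fixes a :: "'a::real_normed_field"
  obtains p where "degree p \<le> d" "\<And>z. poly p z = ln_taylor d (z / a)"
proof
  let ?p = "\<Sum>j\<le>d. monom ((-1) ^ Suc j / of_nat j / a ^ j) j"
  show "degree ?p \<le> d"
    by (intro degree_sum_le) (auto intro: order_trans[OF degree_monom_le])
  show "poly ?p z = ln_taylor d (z / a)" for z
    by (simp add: poly_sum poly_monom ln_taylor_def power_divide)
qed

lemma weierstrass_correction_polynomial:
  obtains p :: "'a::real_normed_field poly"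
  where "degree p \<le> n + 1" "\<And>z. poly p z = weierstrass_correction n N z"
proof -
  have "\<exists>t. \<forall>k::nat. degree (t k) \<le> n + 1 \<and> (\<forall>z::'a. poly (t k) z = ln_taylor (n + 1) (z / of_nat k))"
    by (intro choice allI) (metis ln_taylor_polynomial)
  then obtain t :: "nat \<Rightarrow> 'a poly" where t: "\<And>k. degree (t k) \<le> n + 1"
    "\<And>k z. poly (t k) z = ln_taylor (n + 1) (z / of_nat k)" by blast
  let ?p = "\<Sum>k\<in>{1..<N}. smult (of_nat ((n + k) choose n)) ([:of_real (ln (real k)):] + t k)"
  show ?thesis
  proof
    show "degree ?p \<le> n + 1"
      using t(1) by (intro degree_sum_le order_trans[OF degree_smult_le] degree_add_le) auto
    show "poly ?p z = weierstrass_correction n N z" for z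
      by (simp add: poly_sum weierstrass_correction_def t(2))
  qed
qed

lemma of_real_weierstrass_correction:
  "of_real (weierstrass_correction n N x) = weierstrass_correction n N (of_real x)"
  by (simp add: weierstrass_correction_def of_real_ln_taylor)

section \<open>The functional equation up to a polynomial\<close>

text \<open>
  The partial logarithms on the positive axis. There the limit of the polynomials in the functional
  equation can be taken without an ambiguity by multiples of \<open>2 \<pi> \<i>\<close>, and all coefficients are real,
  which later gives positive values on \<open>(0, \<infinity>)\<close>.
\<close>

definition real_partial_log :: "nat \<Rightarrow> nat \<Rightarrow> real \<Rightarrow> real" where
  "real_partial_log n N x =
     (\<Sum>k<N. of_nat ((n + k) choose n) * ln (real k + x)) - weierstrass_correction n N x"

definition real_weierstrass_log :: "nat \<Rightarrow> real \<Rightarrow> real" where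
  "real_weierstrass_log n x = Re (weierstrass_log n (of_real x))"

lemma partial_log_of_real:
  assumes "x > 0"
  shows "partial_log n N (of_real x) = of_real (real_partial_log n N x)"
proof -
  have "Ln (of_nat k + complex_of_real x) = of_real (ln (real k + x))" for k
    using assms Ln_of_real[of "real k + x"] by simp
  thus ?thesis
    by (simp add: partial_log_def real_partial_log_def of_real_weierstrass_correction)
qed

lemma real_partial_log_tendsto:
  assumes "x > 0"
  shows "(\<lambda>N. real_partial_log n N x) \<longlonglongrightarrow> real_weierstrass_log n x"
  using tendsto_Re[OF partial_log_tendsto[of "of_real x" n]] assms
  by (simp add: partial_log_of_real real_weierstrass_log_def)

lemma weierstrass_log_of_real:
  assumes "x > 0"
  shows "weierstrass_log n (of_real x) = of_real (real_weierstrass_log n x)"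
proof (rule LIMSEQ_unique)
  show "(\<lambda>N. partial_log n N (of_real x)) \<longlonglongrightarrow> weierstrass_log n (of_real x)"
    using assms by (intro partial_log_tendsto) auto
  show "(\<lambda>N. partial_log n N (of_real x)) \<longlonglongrightarrow> of_real (real_weierstrass_log n x)"
    unfolding partial_log_of_real[OF assms] by (intro tendsto_of_real real_partial_log_tendsto assms)
qed

text \<open>
  By Pascal's rule, the difference of the exponents for \<open>n + 1\<close> and \<open>n\<close> at \<open>k\<close> is the exponent for
  \<open>n + 1\<close> at \<open>k - 1\<close>; so everything except one boundary term cancels.
\<close>

lemma log_sum_telescope:
  fixes x :: real
  shows "(\<Sum>k<Suc M. real ((Suc n + k) choose Suc n) * ln (real k + x))
       - (\<Sum>k<Suc M. real ((n + k) choose n) * ln (real k + x))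
       - (\<Sum>k<Suc M. real ((Suc n + k) choose Suc n) * ln (real k + (x + 1)))
       = - real ((Suc n + M) choose Suc n) * ln (real (Suc M) + x)"
proof (induction M)
  case (Suc M)
  have pascal: "(Suc n + Suc M) choose Suc n = ((n + Suc M) choose n) + ((Suc n + M) choose Suc n)"
    by simp
  have "real (Suc M) + (x + 1) = real (Suc (Suc M)) + x" by simp
  thus ?case
    using Suc.IH unfolding sum.lessThan_Suc[of _ "Suc M"] pascal
    by (simp only: of_nat_add) (simp add: algebra_simps)
qed (simp add: add.commute)

text \<open>
  The boundary term of the telescoping sum is a polynomial of degree \<open>n + 1\<close> up to a vanishing error:
  the exponent is of order \<open>M ^ (n + 1)\<close>, the error of the Taylor polynomial of order
  \<open>1 / M ^ (n + 2)\<close>.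
\<close>

lemma log_shift_remainder_tendsto_0:
  assumes "x > 0"
  shows "(\<lambda>M. real ((Suc n + M) choose Suc n) *
     (ln (real (Suc M) + x) - (ln (real (Suc M)) + ln_taylor (n + 1) (x / real (Suc M))))) \<longlonglongrightarrow> 0"
    (is "?f \<longlonglongrightarrow> 0")
proof (rule Lim_null_comparison)
  show "(\<lambda>M. 2 * x ^ (n + 2) * (1 / real (Suc M))) \<longlonglongrightarrow> 0"
    using tendsto_mult_right_zero[OF LIMSEQ_Suc[OF lim_1_over_n]] by simp
  obtain M0 where M0: "2 * x \<le> real M0" using real_arch_simple by blast
  have "norm (?f M) \<le> 2 * x ^ (n + 2) * (1 / real (Suc M))" if M: "M \<ge> M0" for M
  proof -
    define K where "K = real (Suc M)"
    have K: "K > 0" "2 * x \<le> K" using M M0 by (auto simp: K_def)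
    have "ln (K + x) = ln (K * (1 + x / K))" using K by (simp add: distrib_left)
    also have "\<dots> = ln K + ln (1 + x / K)"
      using K assms by (intro ln_mult_pos) (auto simp: add_pos_pos)
    finally have ln: "ln (K + x) - (ln K + ln_taylor (n + 1) (x / K))
                = ln (1 + x / K) - ln_taylor (n + 1) (x / K)" by simp
    have "complex_of_real (ln (1 + x / K) - ln_taylor (n + 1) (x / K))
            = Ln (1 + of_real (x / K)) - ln_taylor (n + 1) (of_real (x / K))"
      using K assms Ln_of_real[of "1 + x / K"] by (simp add: of_real_ln_taylor add_pos_pos)
    hence "\<bar>ln (1 + x / K) - ln_taylor (n + 1) (x / K)\<bar>
            = norm (Ln (1 + of_real (x / K)) - ln_taylor (n + 1) (of_real (x / K)))"
      by (metis norm_of_real)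
    also have "\<dots> \<le> 2 * norm (complex_of_real (x / K)) ^ Suc (n + 1)"
      using K assms by (intro norm_Ln_minus_taylor_le) (simp add: norm_divide field_simps)
    also have "\<dots> = 2 * (x / K) ^ (n + 2)"
      using K assms by (simp add: norm_divide power_divide)
    finally have 1: "\<bar>ln (1 + x / K) - ln_taylor (n + 1) (x / K)\<bar> \<le> 2 * (x / K) ^ (n + 2)" .
    have "real ((Suc n + M) choose Suc n) \<le> real ((M + 1) ^ Suc n)"
      using choose_le_power[of "Suc n" M] by (intro of_nat_mono)
    also have "\<dots> = K ^ Suc n" unfolding K_def of_nat_power by simp
    finally have 2: "real ((Suc n + M) choose Suc n) \<le> K ^ Suc n" .
    have "norm (?f M) \<le> K ^ Suc n * (2 * (x / K) ^ (n + 2))"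
      unfolding K_def [symmetric] ln real_norm_def abs_mult using 1 2 K
      by (intro mult_mono) auto
    also have "\<dots> = 2 * x ^ (n + 2) * (1 / K)"
      using K by (simp add: field_simps)
    finally show ?thesis by (simp add: K_def)
  qed
  thus "\<forall>\<^sub>F M in sequentially. norm (?f M) \<le> 2 * x ^ (n + 2) * (1 / real (Suc M))"
    unfolding eventually_at_top_linorder by blast
qed

text \<open>
  The functional equation holds up to a polynomial: for the partial logarithms the defect is a
  polynomial of degree at most \<open>n + 1\<close> plus an error that tends to \<open>0\<close>, and pointwise limits of
  polynomials of bounded degree are polynomials. The degree is \<open>n + 1\<close> and not \<open>n + 2\<close> because the
  correction of degree \<open>n + 2\<close> enters only through its forward difference.
\<close>

lemma weierstrass_log_functional_equation:
  "\<exists>p. degree p \<le> n + 1 \<and> (\<forall>x>0. real_weierstrass_log (Suc n) x - real_weierstrass_log n x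
         - real_weierstrass_log (Suc n) (x + 1) = poly p x)"
proof -
  let ?c = "\<lambda>M. real ((Suc n + M) choose Suc n)"
  have "\<exists>q. \<forall>N. degree (q N) \<le> Suc (n + 1) \<and> (\<forall>x. poly (q N) x = weierstrass_correction (Suc n) N (x::real))"
    by (intro choice allI) (metis weierstrass_correction_polynomial add_Suc)
  then obtain q where q: "\<And>N. degree (q N) \<le> Suc (n + 1)"
    "\<And>N x. poly (q N) x = weierstrass_correction (Suc n) N (x::real)" by blast
  have "\<exists>q. \<forall>N. degree (q N) \<le> n + 1 \<and> (\<forall>x. poly (q N) x = weierstrass_correction n N (x::real))"
    by (intro choice allI) (metis weierstrass_correction_polynomial)
  then obtain q' where q': "\<And>N. degree (q' N) \<le> n + 1"
    "\<And>N x. poly (q' N) x = weierstrass_correction n N (x::real)" by blast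
  have "\<exists>t. \<forall>M. degree (t M) \<le> n + 1 \<and> (\<forall>x. poly (t M) x = ln_taylor (n + 1) (x / real (Suc M)))"
    by (intro choice allI) (metis ln_taylor_polynomial)
  then obtain t where t: "\<And>M. degree (t M) \<le> n + 1"
    "\<And>M x. poly (t M) x = ln_taylor (n + 1) (x / real (Suc M))" by blast
  define p where "p M = (pcompose (q (Suc M)) [:1, 1:] - q (Suc M)) + q' (Suc M)
                          - smult (?c M) ([:ln (real (Suc M)):] + t M)" for M
  have deg: "degree (p M) \<le> n + 1" for M
    unfolding p_def using q q' t
    by (intro degree_diff_le degree_add_le degree_forward_difference_le
          order_trans[OF degree_smult_le]) auto
  have "\<exists>p. degree p \<le> n + 1 \<and> (\<forall>x\<in>{0<..}. poly p x = real_weierstrass_log (Suc n) x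
          - real_weierstrass_log n x - real_weierstrass_log (Suc n) (x + 1))"
  proof (rule polynomial_pointwise_limit[OF deg])
    show "infinite {0::real<..}" by (rule infinite_Ioi)
  next
    fix x :: real assume "x \<in> {0<..}"
    hence x: "x > 0" by simp
    let ?D = "\<lambda>M. real_partial_log (Suc n) (Suc M) x - real_partial_log n (Suc M) x
                    - real_partial_log (Suc n) (Suc M) (x + 1)"
    let ?E = "\<lambda>M. ?c M * (ln (real (Suc M) + x) -
                (ln (real (Suc M)) + ln_taylor (n + 1) (x / real (Suc M))))"
    have "poly (p M) x = ?D M + ?E M" for M
    proof -
      have "poly (p M) x = weierstrass_correction (Suc n) (Suc M) (x + 1)
              - weierstrass_correction (Suc n) (Suc M) x + weierstrass_correction n (Suc M) x
              - ?c M * (ln (real (Suc M)) + ln_taylor (n + 1) (x / real (Suc M)))"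
        unfolding p_def by (simp add: poly_pcompose q(2) q'(2) t(2) add.commute)
      moreover have "?D M = weierstrass_correction (Suc n) (Suc M) (x + 1)
              - weierstrass_correction (Suc n) (Suc M) x + weierstrass_correction n (Suc M) x
              - ?c M * ln (real (Suc M) + x)"
        using log_sum_telescope[where n = n and M = M and x = x] unfolding real_partial_log_def by linarith
      ultimately show ?thesis by (simp only: right_diff_distrib) 
    qed
    moreover have "?D \<longlonglongrightarrow> real_weierstrass_log (Suc n) x - real_weierstrass_log n x
                         - real_weierstrass_log (Suc n) (x + 1)"
      using x by (intro tendsto_diff LIMSEQ_Suc[OF real_partial_log_tendsto]) auto
    from tendsto_add[OF this log_shift_remainder_tendsto_0[OF x, of n]]
    have "(\<lambda>M. ?D M + ?E M) \<longlonglongrightarrow> real_weierstrass_log (Suc n) x - real_weierstrass_log n x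
                         - real_weierstrass_log (Suc n) (x + 1)" by simp
    ultimately show "(\<lambda>M. poly (p M) x) \<longlonglongrightarrow> real_weierstrass_log (Suc n) x - real_weierstrass_log n x
                         - real_weierstrass_log (Suc n) (x + 1)" by presburger
  qed
  thus ?thesis by auto
qed

text \<open>
  If \<open>exp Q\<close> normalises the product for \<open>n\<close>, then \<open>exp Q'\<close> normalises the product for \<open>n + 1\<close>: the
  defect is removed by solving a difference equation for \<open>Q'\<close>, whose free constant gives the value \<open>1\<close>
  at \<open>1\<close>.
\<close>

lemma next_normalising_polynomial:
  fixes Q :: "real poly"
  assumes "degree Q \<le> n + 1"
  obtains Q' where "degree Q' \<le> n + 2"
    "\<And>x. x > 0 \<Longrightarrow> poly Q' x + real_weierstrass_log (Suc n) x =
       (poly Q x + real_weierstrass_log n x) + (poly Q' (x + 1) + real_weierstrass_log (Suc n) (x + 1))"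
    "poly Q' 1 + real_weierstrass_log (Suc n) 1 = 0"
proof -
  obtain p where p: "degree p \<le> n + 1"
    "\<And>x. x > 0 \<Longrightarrow> real_weierstrass_log (Suc n) x - real_weierstrass_log n x
         - real_weierstrass_log (Suc n) (x + 1) = poly p x"
    using weierstrass_log_functional_equation by blast
  have "degree (p - Q) \<le> n + 1" using p(1) assms by (intro degree_diff_le)
  then obtain R where R: "degree R \<le> Suc (n + 1)" "pcompose R [:1, 1:] - R = p - Q"
    using polynomial_antidifference by blast
  define Q' where "Q' = R - [:poly R 1 + real_weierstrass_log (Suc n) 1:]"
  have "degree Q' \<le> n + 2" unfolding Q'_def using R(1) by (intro degree_diff_le) auto
  moreover have "poly Q' x + real_weierstrass_log (Suc n) x =
       (poly Q x + real_weierstrass_log n x) + (poly Q' (x + 1) + real_weierstrass_log (Suc n) (x + 1))"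
    if "x > 0" for x
  proof -
    have "poly (pcompose R [:1, 1:] - R) x = poly (p - Q) x" by (simp only: R(2))
    thus ?thesis using p(2)[OF that] by (simp add: Q'_def poly_pcompose add.commute)
  qed
  moreover have "poly Q' 1 + real_weierstrass_log (Suc n) 1 = 0" by (simp add: Q'_def)
  ultimately show ?thesis using that by blast
qed

section \<open>Uniqueness by a higher Bohr-Mollerup argument\<close>

text \<open>
  Iterated real derivatives along the positive axis can be computed as iterated complex derivatives
  of a holomorphic extension; in particular the functions are smooth there.
\<close>

lemma higher_deriv_Re_of_real:
  fixes F :: "complex \<Rightarrow> complex" and f :: "real \<Rightarrow> real"
  assumes F: "F holomorphic_on {z. Re z > 0}" and f: "\<And>t. t > 0 \<Longrightarrow> f t = Re (F (of_real t))"
  shows "x > 0 \<Longrightarrow> (deriv ^^ j) f x = Re ((deriv ^^ j) F (of_real x))"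
    and "x > 0 \<Longrightarrow> ((deriv ^^ j) f has_real_derivative (deriv ^^ Suc j) f x) (at x)"
proof -
  let ?G = "\<lambda>j t. Re ((deriv ^^ j) F (of_real t))"
  have G: "(?G j has_real_derivative ?G (Suc j) x) (at x)" if "x > 0" for j x
  proof -
    have "((deriv ^^ j) F has_field_derivative (deriv ^^ Suc j) F (of_real x)) (at (of_real x))"
      using F open_halfspace_Re_gt that by (intro has_field_derivative_higher_deriv) auto
    hence "((\<lambda>t. (deriv ^^ j) F (of_real t)) has_vector_derivative (deriv ^^ Suc j) F (of_real x)) (at x)"
      by (rule has_vector_derivative_real_field)
    from bounded_linear.has_vector_derivative[OF bounded_linear_Re this]
    show ?thesis by (simp add: has_real_derivative_iff_has_vector_derivative)
  qed
  have d: "(h has_real_derivative ?G (Suc j) x) (at x)"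
    if "x > 0" "\<And>t. t > 0 \<Longrightarrow> h t = ?G j t" for h j x
    using G[OF that(1)] by (rule has_field_derivative_transform_within_open[where S = "{0<..}"])
      (use that in auto)
  have eq: "x > 0 \<Longrightarrow> (deriv ^^ j) f x = ?G j x" for j x
  proof (induction j arbitrary: x)
    case (Suc j)
    from DERIV_imp_deriv[OF d[OF Suc.prems Suc.IH]] show ?case by simp
  qed (simp add: f)
  show "x > 0 \<Longrightarrow> (deriv ^^ j) f x = ?G j x" by (rule eq)
  show "x > 0 \<Longrightarrow> ((deriv ^^ j) f has_real_derivative (deriv ^^ Suc j) f x) (at x)"
    using d[OF _ eq] eq[of x "Suc j"] by simp
qed

lemma shift_equation_derivatives:
  fixes U W :: "nat \<Rightarrow> real \<Rightarrow> real"
  assumes U: "\<And>j x. x > 0 \<Longrightarrow> (U j has_real_derivative U (Suc j) x) (at x)"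
    and W: "\<And>j x. x > 0 \<Longrightarrow> (W j has_real_derivative W (Suc j) x) (at x)"
    and eq: "\<And>x. x > 0 \<Longrightarrow> U 0 (x + 1) = U 0 x + W 0 x"
  shows "x > 0 \<Longrightarrow> U j (x + 1) = U j x + W j x"
proof (induction j arbitrary: x)
  case (Suc j)
  have "((\<lambda>x. U j (x + 1)) has_real_derivative U (Suc j) (x + 1)) (at x)"
    using U[of "x + 1" j] Suc.prems by (simp add: DERIV_shift)
  moreover have "((\<lambda>x. U j (x + 1)) has_real_derivative U (Suc j) x + W (Suc j) x) (at x)"
    by (rule has_field_derivative_transform_within_open[where S = "{0<..}",
          OF DERIV_add[OF U[OF Suc.prems, of j] W[OF Suc.prems, of j]]])
       (use Suc in auto)
  ultimately show ?case by (rule DERIV_unique)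
qed (rule eq)

text \<open>
  If \<open>D (m + 1)\<close> is constant, then the constant is \<open>0\<close>, since \<open>D m\<close> takes equal values at \<open>x\<close> and
  \<open>x + 1\<close>; hence \<open>D m\<close> is constant as well.
\<close>

lemma periodic_eq_const_if_higher_deriv_const:
  fixes D :: "nat \<Rightarrow> real \<Rightarrow> real"
  assumes D: "\<And>j x. x > 0 \<Longrightarrow> (D j has_real_derivative D (Suc j) x) (at x)"
    and per: "\<And>j x. x > 0 \<Longrightarrow> D j (x + 1) = D j x"
    and const: "\<And>x y. x > 0 \<Longrightarrow> y > 0 \<Longrightarrow> D m x = D m y"
  shows "x > 0 \<Longrightarrow> y > 0 \<Longrightarrow> D 0 x = D 0 y"
  using const
proof (induction m arbitrary: x y)
  case (Suc m)
  have zero: "D (Suc m) x = 0" if x: "x > 0" for x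
  proof -
    have "\<exists>t>x. t < x + 1 \<and> D m (x + 1) - D m x = (x + 1 - x) * D (Suc m) t"
      using x by (intro MVT2 D) auto
    then obtain t where t: "t > x" "D m (x + 1) - D m x = (x + 1 - x) * D (Suc m) t" by blast
    thus ?thesis using per[OF x, of m] Suc.prems(3)[of x t] x by simp
  qed
  have "D m x = D m y" if xy: "x > 0" "y > 0" for x y
  proof (rule DERIV_isconst3[where f = "D m" and x = x and y = y and a = 0 and b = "max x y + 1"])
    show "(D m has_real_derivative 0) (at t)" if "t \<in> {0<..<max x y + 1}" for t
      using D[of t m] zero[of t] that by simp
  qed (use xy in auto)
  thus ?case using Suc.IH Suc.prems(1,2) by blast
qed

text \<open>
  The difference \<open>D\<close> of two solutions is periodic. The functions \<open>s * U m\<close> and \<open>s * V m\<close> are monotone and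
  both increase by \<open>s * W m x\<close> from \<open>x\<close> to \<open>x + 1\<close>, so the oscillation of \<open>s * D m\<close> on this interval is at
  most \<open>s * W m x\<close>. By periodicity \<open>x\<close> can be moved to infinity, where this bound tends to \<open>0\<close>.
  Hence \<open>D m\<close> is constant, and a periodic function with a constant derivative of some order is constant.
\<close>

lemma higher_Bohr_Mollerup_uniqueness:
  fixes U V W :: "nat \<Rightarrow> real \<Rightarrow> real" and s :: real
  assumes U: "\<And>j x. x > 0 \<Longrightarrow> (U j has_real_derivative U (Suc j) x) (at x)"
    and V: "\<And>j x. x > 0 \<Longrightarrow> (V j has_real_derivative V (Suc j) x) (at x)"
    and W: "\<And>j x. x > 0 \<Longrightarrow> (W j has_real_derivative W (Suc j) x) (at x)"
    and eqU: "\<And>x. x > 0 \<Longrightarrow> U 0 (x + 1) = U 0 x + W 0 x"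
    and eqV: "\<And>x. x > 0 \<Longrightarrow> V 0 (x + 1) = V 0 x + W 0 x"
    and s: "s \<noteq> 0"
    and sU: "\<And>x. x > 0 \<Longrightarrow> s * U (Suc m) x \<ge> 0"
    and sV: "\<And>x. x > 0 \<Longrightarrow> s * V (Suc m) x \<ge> 0"
    and lim: "\<And>x. x > 0 \<Longrightarrow> (\<lambda>N. W m (x + real N)) \<longlonglongrightarrow> 0"
    and xy: "x > 0" "y > 0"
  shows "U 0 x - V 0 x = U 0 y - V 0 y"
proof -
  define D where "D j x = U j x - V j x" for j x
  have D: "(D j has_real_derivative D (Suc j) x) (at x)" if "x > 0" for j x
    unfolding D_def using U V that by (intro DERIV_diff)
  have stepU: "U j (x + 1) = U j x + W j x" if "x > 0" for j x
    using shift_equation_derivatives[OF U W eqU that] .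
  have stepV: "V j (x + 1) = V j x + W j x" if "x > 0" for j x
    using shift_equation_derivatives[OF V W eqV that] .
  have per: "D j (x + 1) = D j x" if "x > 0" for j x
    using stepU[OF that] stepV[OF that] by (simp add: D_def)
  have pern: "D j (x + real N) = D j x" if "x > 0" for j x N
  proof (induction N)
    case (Suc N)
    have "x + real (Suc N) = (x + real N) + 1" by simp
    thus ?case using Suc per[of "x + real N" j] that by (simp only: add_pos_nonneg of_nat_0_le_iff)
  qed simp
  have mono: "s * A m x \<le> s * A m y"
    if "0 < x" "x \<le> y" "\<And>x. x > 0 \<Longrightarrow> (A m has_real_derivative A (Suc m) x) (at x)"
       "\<And>x. x > 0 \<Longrightarrow> s * A (Suc m) x \<ge> 0" for A :: "nat \<Rightarrow> real \<Rightarrow> real" and x y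
  proof (rule DERIV_nonneg_imp_nondecreasing[OF that(2)])
    fix t assume "x \<le> t"
    hence "t > 0" using that(1) by simp
    thus "\<exists>d. ((\<lambda>x. s * A m x) has_real_derivative d) (at t) \<and> d \<ge> 0"
      using DERIV_cmult[OF that(3)] that(4) by blast
  qed
  have local: "D m y = D m x" if x: "x > 0" and y: "x \<le> y" "y \<le> x + 1" for x y
  proof -
    have bound: "\<bar>s * (D m y - D m x)\<bar> \<le> s * W m (x + real N)" for N
    proof -
      let ?x = "x + real N" and ?y = "y + real N"
      have "s * U m ?x \<le> s * U m ?y" "s * U m ?y \<le> s * U m (?x + 1)"
           "s * V m ?x \<le> s * V m ?y" "s * V m ?y \<le> s * V m (?x + 1)"
        using x y by (auto intro!: mono[OF _ _ U sU] mono[OF _ _ V sV])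
      moreover have "s * U m (?x + 1) = s * U m ?x + s * W m ?x"
        "s * V m (?x + 1) = s * V m ?x + s * W m ?x"
        using stepU[of ?x m] stepV[of ?x m] x by (auto simp: distrib_left)
      ultimately have "\<bar>s * (D m ?y - D m ?x)\<bar> \<le> s * W m ?x"
        unfolding D_def right_diff_distrib by linarith
      thus ?thesis using pern[of x m N] pern[of y m N] x y by simp
    qed
    have "(\<lambda>N. s * W m (x + real N)) \<longlonglongrightarrow> s * 0"
      by (intro tendsto_intros lim x)
    hence "\<bar>s * (D m y - D m x)\<bar> \<le> s * 0"
      by (rule LIMSEQ_le_const) (use bound in auto)
    thus ?thesis using s by simp
  qed
  have le: "D m x = D m y" if "x > 0" "x \<le> y" for x y
  proof -
    define N where "N = nat \<lfloor>y - x\<rfloor>"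
    have "real N \<le> y - x" "y - x \<le> real N + 1"
      using that unfolding N_def by (auto simp: of_nat_nat)
    hence "D m (y - real N) = D m x" using that by (intro local) auto
    moreover have "D m (y - real N) = D m y"
      using pern[of "y - real N" m N] \<open>real N \<le> y - x\<close> that by simp
    ultimately show ?thesis by simp
  qed
  have const: "D m x = D m y" if xy: "x > 0" "y > 0" for x y
  proof (rule linorder_le_cases[of x y])
    assume "x \<le> y" thus ?thesis by (rule le[OF xy(1)])
  next
    assume "y \<le> x" thus ?thesis by (rule le[OF xy(2), symmetric])
  qed
  have "D 0 x = D 0 y"
    by (rule periodic_eq_const_if_higher_deriv_const[where D = D and m = m, OF D per const xy])
  thus ?thesis by (simp add: D_def)
qed

lemma connected_complement_nonpos_Ints: "connected (- \<int>\<^sub>\<le>\<^sub>0 :: complex set)"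
proof -
  have "countable (\<int>\<^sub>\<le>\<^sub>0 :: complex set)"
    using countable_subset[OF nonpos_Ints_subset_Ints countable_int] .
  hence "connected (UNIV - \<int>\<^sub>\<le>\<^sub>0 :: complex set)"
    by (intro connected_open_diff_countable) auto
  thus ?thesis by (simp add: Compl_eq_Diff_UNIV)
qed

lemma one_islimpt_positive_reals: "(1::complex) islimpt of_real ` {0<..}"
proof -
  have "(\<lambda>n. complex_of_real (1 + inverse (real (Suc n)))) \<longlonglongrightarrow> of_real (1 + 0)"
    by (intro tendsto_of_real tendsto_add tendsto_const LIMSEQ_inverse_real_of_nat)
  moreover have "complex_of_real (1 + inverse (real (Suc n))) \<in> of_real ` {0<..} - {1}" for n
    by (auto simp: add_pos_pos simp del: of_real_add of_real_inverse of_nat_Suc)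
  ultimately show ?thesis unfolding islimpt_sequential by (intro exI conjI allI) auto
qed

text \<open>
  The right half-plane is contractible and contains no zeros or poles, so there is a holomorphic
  logarithm; its real part on the positive axis is the real logarithm.
\<close>

lemma is_multiple_Gamma_log:
  assumes "is_multiple_Gamma m g f"
  obtains F where "F holomorphic_on {z. Re z > 0}"
    "\<And>x. x > 0 \<Longrightarrow> ln (Re (f (of_real x))) = Re (F (of_real x))"
proof -
  have nonpos: "z \<notin> \<int>\<^sub>\<le>\<^sub>0" if "Re z > 0" for z
    using that by (auto elim!: nonpos_Ints_cases')
  have nice: "f nicely_meromorphic_on UNIV" and poles: "\<And>z. is_pole f z \<longleftrightarrow> z \<in> \<int>\<^sub>\<le>\<^sub>0"
    and nz: "\<And>z. z \<notin> \<int>\<^sub>\<le>\<^sub>0 \<Longrightarrow> f z \<noteq> 0"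
    and pos: "\<And>x::real. x > 0 \<Longrightarrow> f (of_real x) \<in> \<real> \<and> Re (f (of_real x)) > 0"
    using assms unfolding is_multiple_Gamma_def by auto
  have "f analytic_on {z}" if "Re z > 0" for z
    using nicely_meromorphic_on_imp_analytic_at[OF nice] poles nonpos[OF that] by auto
  hence "f holomorphic_on {z. Re z > 0}"
    by (intro analytic_imp_holomorphic) (subst analytic_on_analytic_at, auto)
  moreover have "contractible {z::complex. Re z > 0}"
    by (intro convex_imp_contractible convex_halfspace_Re_gt)
  ultimately obtain F where F: "F holomorphic_on {z. Re z > 0}" "\<And>z. z \<in> {z. Re z > 0} \<Longrightarrow> f z = exp (F z)"
    using contractible_imp_holomorphic_log[of f "{z. Re z > 0}"] nz nonpos by blast
  have "ln (Re (f (of_real x))) = Re (F (of_real x))" if x: "x > 0" for x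
  proof -
    have "Re (f (of_real x)) = norm (f (of_real x))"
      using pos[OF x] by (auto elim!: Reals_cases)
    also have "\<dots> = exp (Re (F (of_real x)))" using F(2)[of "of_real x"] x by simp
    finally show ?thesis by simp
  qed
  with F(1) that show ?thesis by blast
qed

text \<open>
  Uniqueness on the positive axis is the higher Bohr-Mollerup argument for the logarithms, together
  with the value \<open>1\<close> at \<open>1\<close>. The identity theorem on the connected complement of the poles extends it,
  and at the poles both functions have the value \<open>0\<close>.
\<close>

lemma is_multiple_Gamma_unique:
  assumes f1: "is_multiple_Gamma m g f1" and f2: "is_multiple_Gamma m g f2"
    and L: "L holomorphic_on {z. Re z > 0}"
    and g: "\<And>x. x > 0 \<Longrightarrow> g (of_real x) = of_real (exp (- Re (L (of_real x))))"
    and lim: "\<And>x. x > 0 \<Longrightarrow> (\<lambda>N. Re ((deriv ^^ m) L (of_real (x + real N)))) \<longlonglongrightarrow> 0"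
  shows "f1 = f2"
proof -
  let ?l = "\<lambda>f t. ln (Re (f (complex_of_real t)))"
  let ?w = "\<lambda>t. Re (L (of_real t))"
  have smooth: "((deriv ^^ j) (?l f) has_real_derivative (deriv ^^ Suc j) (?l f) x) (at x)"
    if "is_multiple_Gamma m g f" "x > 0" for f j x
    using is_multiple_Gamma_log[OF that(1)] higher_deriv_Re_of_real(2)[of _ "?l f"] that(2) by metis
  have step: "(deriv ^^ 0) (?l f) (x + 1) = (deriv ^^ 0) (?l f) x + (deriv ^^ 0) ?w x"
    if f: "is_multiple_Gamma m g f" and x: "x > 0" for f x
  proof -
    have "complex_of_real x \<notin> \<int>\<^sub>\<le>\<^sub>0" using x by (auto elim!: nonpos_Ints_cases' simp: complex_eq_iff)
    hence "f (of_real x + 1) = f (of_real x) / g (of_real x)"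
      using f unfolding is_multiple_Gamma_def by blast
    hence "Re (f (of_real (x + 1))) = Re (f (of_real x)) * exp (?w x)"
      using g[OF x] by (simp add: exp_minus divide_inverse del: of_real_exp)
    moreover have "Re (f (of_real x)) > 0" using f x unfolding is_multiple_Gamma_def by blast
    ultimately show ?thesis by (simp add: ln_mult_pos)
  qed
  have sign: "(-1) ^ (m + 1) * (deriv ^^ Suc m) (?l f) x \<ge> 0"
    if "is_multiple_Gamma m g f" "x > 0" for f x
    using that unfolding is_multiple_Gamma_def by simp
  have limw: "(\<lambda>N. (deriv ^^ m) ?w (x + real N)) \<longlonglongrightarrow> 0" if x: "x > 0" for x
  proof -
    have "(deriv ^^ m) ?w (x + real N) = Re ((deriv ^^ m) L (of_real (x + real N)))" for N
      using x by (intro higher_deriv_Re_of_real(1)[OF L]) auto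
    thus ?thesis using lim[OF x] by simp
  qed
  have diff: "(deriv ^^ 0) (?l f1) x - (deriv ^^ 0) (?l f2) x = (deriv ^^ 0) (?l f1) 1 - (deriv ^^ 0) (?l f2) 1"
    if x: "x > 0" for x
    by (rule higher_Bohr_Mollerup_uniqueness[where U = "\<lambda>j. (deriv ^^ j) (?l f1)"
          and V = "\<lambda>j. (deriv ^^ j) (?l f2)" and W = "\<lambda>j. (deriv ^^ j) ?w"
          and s = "(-1) ^ (m + 1)" and m = m,
          OF smooth[OF f1] smooth[OF f2] higher_deriv_Re_of_real(2)[OF L refl]
             step[OF f1] step[OF f2] _ sign[OF f1] sign[OF f2] limw x]) auto
  have eq_real: "f1 (of_real x) = f2 (of_real x)" if x: "x > 0" for x
  proof -
    have "f1 1 = 1" "f2 1 = 1" and r: "f1 (of_real x) \<in> \<real>" "f2 (of_real x) \<in> \<real>"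
      and p: "Re (f1 (of_real x)) > 0" "Re (f2 (of_real x)) > 0"
      using f1 f2 x unfolding is_multiple_Gamma_def by auto
    hence "Re (f1 (of_real x)) = Re (f2 (of_real x))" using diff[OF x] by simp
    with r show ?thesis by (metis of_real_Re)
  qed
  have hol: "f holomorphic_on - \<int>\<^sub>\<le>\<^sub>0" if f: "is_multiple_Gamma m g f" for f
  proof -
    have "f analytic_on {z}" if "z \<notin> \<int>\<^sub>\<le>\<^sub>0" for z
      using f that unfolding is_multiple_Gamma_def
      by (intro nicely_meromorphic_on_imp_analytic_at[of f UNIV]) auto
    thus ?thesis by (intro analytic_imp_holomorphic) (subst analytic_on_analytic_at, auto)
  qed
  have junk: "f z = 0" if f: "is_multiple_Gamma m g f" and z: "z \<in> \<int>\<^sub>\<le>\<^sub>0" for f z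
  proof -
    have p: "is_pole f z" and "f nicely_meromorphic_on UNIV"
      using f z unfolding is_multiple_Gamma_def by auto
    hence "(is_pole f z \<and> f z = 0) \<or> f \<midarrow>z\<rightarrow> f z" unfolding nicely_meromorphic_on_def by blast
    thus ?thesis using p not_tendsto_and_filterlim_at_infinity[of "at z" f "f z"]
      by (auto simp: is_pole_def)
  qed
  have "f1 z = f2 z" for z
  proof (cases "z \<in> \<int>\<^sub>\<le>\<^sub>0")
    case True
    thus ?thesis using junk f1 f2 by metis
  next
    case False
    have "f1 z - f2 z = 0"
    proof (rule analytic_continuation[where f = "\<lambda>z. f1 z - f2 z" and S = "- \<int>\<^sub>\<le>\<^sub>0" and U = "of_real ` {0<..}" and \<xi> = 1])
      show "(\<lambda>z. f1 z - f2 z) holomorphic_on - \<int>\<^sub>\<le>\<^sub>0"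
        by (intro holomorphic_intros hol f1 f2)
      show "open (- \<int>\<^sub>\<le>\<^sub>0 :: complex set)" by (simp add: open_Compl closed_nonpos_Ints)
      show "of_real ` {0<..} \<subseteq> (- \<int>\<^sub>\<le>\<^sub>0 :: complex set)"
        by (auto elim!: nonpos_Ints_cases' simp: complex_eq_iff)
      show "connected (- \<int>\<^sub>\<le>\<^sub>0 :: complex set)" by (rule connected_complement_nonpos_Ints)
      show "(1::complex) islimpt of_real ` {0<..}" by (rule one_islimpt_positive_reals)
    qed (use eq_real False in auto)
    thus ?thesis by simp
  qed
  thus ?thesis by blast
qed

section \<open>Derivatives of the logarithms\<close>

lemma higher_deriv_poly: "(deriv ^^ j) (poly p) = poly ((pderiv ^^ j) p)"
  for p :: "complex poly"
proof (induction j)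
  case (Suc j)
  have "deriv (poly q) = poly (pderiv q)" for q :: "complex poly"
    by (rule ext, rule DERIV_imp_deriv, rule poly_DERIV)
  thus ?case using Suc by simp
qed simp

lemma higher_pderiv_eq_0:
  fixes p :: "'a::{comm_semiring_1,semiring_no_zero_divisors,semiring_char_0} poly"
  shows "degree p < j \<Longrightarrow> (pderiv ^^ j) p = 0"
proof (induction j arbitrary: p)
  case (Suc j)
  show ?case
  proof (cases "degree p = 0")
    case True
    hence "pderiv p = 0" by (simp add: pderiv_eq_0_iff)
    moreover have "(pderiv ^^ j) (0 :: 'a poly) = 0" by (induction j) auto
    ultimately show ?thesis by (simp add: funpow_Suc_right del: funpow.simps)
  next
    case False
    hence "degree (pderiv p) < j" using Suc.prems by (simp add: degree_pderiv)
    thus ?thesis using Suc.IH by (simp add: funpow_Suc_right del: funpow.simps)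
  qed
qed simp

lemma higher_deriv_Ln_shift:
  assumes "Re z > 0"
  shows "(deriv ^^ Suc j) (\<lambda>z. Ln (of_nat k + z)) z = (-1) ^ j * fact j / (of_nat k + z) ^ Suc j"
  using assms
proof (induction j arbitrary: z)
  case 0
  have "of_nat k + z \<notin> \<real>\<^sub>\<le>\<^sub>0" using 0 by (auto simp: complex_nonpos_Reals_iff)
  hence "((\<lambda>z. Ln (of_nat k + z)) has_field_derivative 1 / (of_nat k + z)) (at z)"
    by (auto intro!: derivative_eq_intros simp: inverse_eq_divide)
  from DERIV_imp_deriv[OF this] show ?case by (simp add: inverse_eq_divide)
next
  case (Suc j)
  have nz: "of_nat k + z \<noteq> 0" using Suc.prems by (auto simp: complex_eq_iff)
  have inv: "((\<lambda>z. inverse (of_nat k + z)) has_field_derivative - (inverse (of_nat k + z) ^ 2)) (at z)"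
    using nz by (auto intro!: derivative_eq_intros simp: power2_eq_square)
  have "((\<lambda>z. (-1) ^ j * fact j / (of_nat k + z) ^ Suc j) has_field_derivative
          (-1) ^ Suc j * fact (Suc j) / (of_nat k + z) ^ Suc (Suc j)) (at z)"
    using DERIV_cmult[OF DERIV_power[OF inv, of "Suc j"], of "(-1) ^ j * fact j"]
    by (simp add: divide_inverse power_inverse power2_eq_square mult_ac)
  hence "((deriv ^^ Suc j) (\<lambda>z. Ln (of_nat k + z)) has_field_derivative
          (-1) ^ Suc j * fact (Suc j) / (of_nat k + z) ^ Suc (Suc j)) (at z)"
    by (rule has_field_derivative_transform_within_open[where S = "{z. Re z > 0}"])
       (use Suc open_halfspace_Re_gt in auto)
  from DERIV_imp_deriv[OF this] show ?case by simp
qed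

lemma higher_deriv_partial_log:
  assumes z: "Re z > 0"
  shows "(deriv ^^ (n + 2)) (partial_log n N) z =
    (-1) ^ (n + 1) * fact (n + 1) * (\<Sum>k<N. of_nat ((n + k) choose n) / (of_nat k + z) ^ (n + 2))"
proof -
  let ?H = "{z. Re z > 0}"
  let ?L = "\<lambda>N z. \<Sum>k<N. of_nat ((n + k) choose n) * Ln (of_nat k + z)"
  have holL: "(\<lambda>z. Ln (of_nat k + z)) holomorphic_on ?H" for k
    by (intro holomorphic_intros) (auto simp: complex_nonpos_Reals_iff)
  have hol1: "(\<lambda>z. of_nat c * Ln (of_nat k + z)) holomorphic_on ?H" for c k :: nat
    by (intro holomorphic_on_mult holomorphic_on_const holL)
  have hol: "?L N holomorphic_on ?H" for N by (intro holomorphic_on_sum hol1)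
  have op: "open ?H" by (rule open_halfspace_Re_gt)
  have holp: "poly p holomorphic_on ?H" for p :: "complex poly"
    unfolding holomorphic_on_open[OF op] using poly_DERIV[of p] by blast
  obtain p :: "complex poly" where p: "degree p \<le> n + 1"
    "\<And>z. poly p z = weierstrass_correction n N z" by (rule weierstrass_correction_polynomial) blast
  have "partial_log n N = (\<lambda>z. ?L N z - poly p z)" by (simp add: partial_log_def p(2) fun_eq_iff)
  hence "(deriv ^^ (n + 2)) (partial_log n N) z = (deriv ^^ (n + 2)) (?L N) z - (deriv ^^ (n + 2)) (poly p) z"
    using higher_deriv_diff[OF hol holp op, of z "n + 2" N] z by simp
  also have "(deriv ^^ (n + 2)) (poly p) z = 0"
    unfolding higher_deriv_poly by (subst higher_pderiv_eq_0) (use p(1) in auto)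
  also have "(deriv ^^ (n + 2)) (?L N) z = (\<Sum>k<N. of_nat ((n + k) choose n) *
               ((-1) ^ (n + 1) * fact (n + 1) / (of_nat k + z) ^ (n + 2)))"
  proof (induction N)
    case (Suc N)
    have "(deriv ^^ (n + 2)) (?L (Suc N)) z = (deriv ^^ (n + 2)) (?L N) z
        + (deriv ^^ (n + 2)) (\<lambda>z. of_nat ((n + N) choose n) * Ln (of_nat N + z)) z"
      unfolding sum.lessThan_Suc using z by (intro higher_deriv_add[OF hol hol1 op]) auto
    also have "(deriv ^^ (n + 2)) (\<lambda>z. of_nat ((n + N) choose n) * Ln (of_nat N + z)) z
        = of_nat ((n + N) choose n) * (deriv ^^ (n + 2)) (\<lambda>z. Ln (of_nat N + z)) z"
      using z by (intro higher_deriv_cmult[OF holL _ op]) auto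
    also have "(deriv ^^ (n + 2)) (\<lambda>z. Ln (of_nat N + z)) z
                 = (-1) ^ (n + 1) * fact (n + 1) / (of_nat N + z) ^ (n + 2)"
      using higher_deriv_Ln_shift[OF z, of "n + 1" N] by (simp only: add_Suc_right one_add_one [symmetric] add.assoc [symmetric] Suc_eq_plus1)
    finally show ?case using Suc.IH by simp
  qed simp
  finally show ?thesis by (simp only: sum_distrib_left times_divide_eq_right mult_ac diff_0_right)
qed

text \<open>
  The summand is at most \<open>1 / (k + x)\<^sup>2\<close>, which is compared with a telescoping series.
\<close>

lemma sum_choose_over_power_le:
  fixes x :: real
  assumes x: "x > 1"
  shows "(\<Sum>k<N. real ((n + k) choose n) / (real k + x) ^ (n + 2)) \<le> 1 / (x - 1)"
proof -
  have "(\<Sum>k<N. real ((n + k) choose n) / (real k + x) ^ (n + 2)) \<le> 1 / (x - 1) - 1 / (real N + x - 1)"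
  proof (induction N)
    case (Suc N)
    let ?y = "real N + x"
    have y: "?y > 1" using x by simp
    have "real ((n + N) choose n) \<le> real ((N + 1) ^ n)" using choose_le_power by (intro of_nat_mono)
    also have "\<dots> \<le> ?y ^ n" unfolding of_nat_power using x by (intro power_mono) auto
    finally have "real ((n + N) choose n) / ?y ^ (n + 2) \<le> ?y ^ n / ?y ^ (n + 2)"
      using y by (intro divide_right_mono) auto
    also have "\<dots> = 1 / ?y ^ 2" using y by (simp add: power_add power2_eq_square)
    also have "\<dots> \<le> 1 / (?y * (?y - 1))"
      using y unfolding power2_eq_square by (intro divide_left_mono mult_left_mono) auto
    also have "\<dots> = 1 / (?y - 1) - 1 / ?y" using y by (simp add: field_simps)
    finally show ?case using Suc.IH by (simp add: algebra_simps)
  qed simp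
  moreover have "1 / (real N + x - 1) \<ge> 0" using x by simp
  ultimately show ?thesis by linarith
qed

section \<open>Construction of the multiple Gamma functions\<close>

text \<open>
  A Weierstrass product with given zeros is determined only up to the exponential of an entire
  function. The multiple Gamma functions are the reciprocals of \<open>normalised_product n Q\<close> for suitable
  real polynomials \<open>Q\<close>; the logarithm is used on the right half-plane only.
\<close>

definition normalised_log :: "nat \<Rightarrow> real poly \<Rightarrow> complex \<Rightarrow> complex" where
  "normalised_log n Q z = poly (map_poly of_real Q) z + weierstrass_log n z"

definition normalised_product :: "nat \<Rightarrow> real poly \<Rightarrow> complex \<Rightarrow> complex" where
  "normalised_product n Q z = exp (poly (map_poly of_real Q) z) * weierstrass_product n z"

lemma poly_map_poly_of_real: "poly (map_poly complex_of_real Q) (of_real x) = of_real (poly Q x)"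
  by (induction Q) (auto simp: map_poly_pCons)

lemma normalised_log_holomorphic: "normalised_log n Q holomorphic_on {z. Re z > 0}"
  unfolding normalised_log_def[abs_def]
  by (intro holomorphic_intros weierstrass_log_holomorphic) 

lemma Re_normalised_log:
  "Re (normalised_log n Q (of_real x)) = poly Q x + real_weierstrass_log n x"
  by (simp add: normalised_log_def poly_map_poly_of_real real_weierstrass_log_def)

lemma normalised_product_of_real:
  assumes "x > 0"
  shows "normalised_product n Q (of_real x) = of_real (exp (poly Q x + real_weierstrass_log n x))"
  using assms exp_weierstrass_log[of "of_real x" n] weierstrass_log_of_real[of x n]
  by (simp add: normalised_product_def poly_map_poly_of_real exp_add exp_of_real)

lemma one_over_normalised_product_of_real:
  assumes "x > 0"
  shows "1 / normalised_product n Q (of_real x) = of_real (exp (- Re (normalised_log n Q (of_real x))))"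
  unfolding normalised_product_of_real[OF assms] Re_normalised_log exp_minus
  by (simp only: of_real_inverse divide_inverse mult_1_left)

lemma normalised_product_holomorphic: "normalised_product n Q holomorphic_on A"
proof (rule holomorphic_on_subset)
  show "normalised_product n Q holomorphic_on UNIV"
    unfolding normalised_product_def[abs_def]
    by (intro holomorphic_intros weierstrass_product_holomorphic)
qed simp

lemma normalised_product_eq_0_iff: "normalised_product n Q z = 0 \<longleftrightarrow> z \<in> \<int>\<^sub>\<le>\<^sub>0"
  by (simp add: normalised_product_def weierstrass_product_eq_0_iff)

text \<open>
  Differentiating \<open>n + 2\<close> times kills all polynomials and leaves the convergent series
  \<open>(-1) ^ (n + 1) * (n + 1)! * (\<Sum>k. (n + k choose n) / (k + x) ^ (n + 2))\<close>. Its sign gives the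
  log-convexity condition, its decay for large \<open>x\<close> the uniqueness in the next step of the recursion.
\<close>

lemma higher_deriv_normalised_log:
  assumes Q: "degree Q \<le> n + 1" and x: "x > 0"
  shows "(-1) ^ (n + 1) * Re ((deriv ^^ (n + 2)) (normalised_log n Q) (of_real x)) \<ge> 0"
    and "x > 1 \<Longrightarrow> \<bar>Re ((deriv ^^ (n + 2)) (normalised_log n Q) (of_real x))\<bar> \<le> fact (n + 1) / (x - 1)"
proof -
  define R where "R = x + 1"
  let ?A = "{z::complex. Re z > 0} \<inter> ball 0 R"
  have A: "open ?A" "of_real x \<in> ?A"
    using x by (auto simp: R_def open_halfspace_Re_gt)
  let ?q = "map_poly complex_of_real Q"
  have "(deriv ^^ (n + 2)) (normalised_log n Q) (of_real x)
          = (deriv ^^ (n + 2)) (poly ?q) (of_real x) + (deriv ^^ (n + 2)) (weierstrass_log n) (of_real x)"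
    unfolding normalised_log_def[abs_def] using x open_halfspace_Re_gt[of 0]
    by (intro higher_deriv_add[where S = "{z. Re z > 0}"])
       (auto intro!: holomorphic_intros weierstrass_log_holomorphic)
  moreover have "degree ?q \<le> n + 1" using Q by (simp add: degree_map_poly)
  hence "(deriv ^^ (n + 2)) (poly ?q) (of_real x) = 0"
    unfolding higher_deriv_poly by (subst higher_pderiv_eq_0) auto
  ultimately have eq: "(deriv ^^ (n + 2)) (normalised_log n Q) (of_real x)
    = (deriv ^^ (n + 2)) (weierstrass_log n) (of_real x)" by simp
  let ?S = "\<lambda>N. \<Sum>k<N. real ((n + k) choose n) / (real k + x) ^ (n + 2)"
  have "(\<lambda>N. (deriv ^^ (n + 2)) (partial_log n N) (of_real x))
          \<longlonglongrightarrow> (deriv ^^ (n + 2)) (weierstrass_log n) (of_real x)"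
  proof (rule higher_deriv_complex_uniform_limit[OF partial_log_uniform_limit _ _ A])
    show "\<forall>\<^sub>F N in sequentially. partial_log n N holomorphic_on ?A"
      by (intro always_eventually allI holomorphic_on_subset[OF partial_log_holomorphic]) auto
  qed simp
  hence lim: "(\<lambda>N. Re ((deriv ^^ (n + 2)) (partial_log n N) (of_real x)))
          \<longlonglongrightarrow> Re ((deriv ^^ (n + 2)) (normalised_log n Q) (of_real x))"
    unfolding eq by (rule tendsto_Re)
  have val: "Re ((deriv ^^ (n + 2)) (partial_log n N) (of_real x)) = (-1) ^ (n + 1) * fact (n + 1) * ?S N" for N
  proof -
    have "(deriv ^^ (n + 2)) (partial_log n N) (of_real x) = of_real ((-1) ^ (n + 1) * fact (n + 1) * ?S N)"
      by (subst higher_deriv_partial_log) (use x in simp_all)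
    thus ?thesis by (simp only: Re_complex_of_real)
  qed
  have S0: "?S N \<ge> 0" for N using x by (intro sum_nonneg) auto
  have "(\<lambda>N. (-1) ^ (n + 1) * ((-1) ^ (n + 1) * fact (n + 1) * ?S N))
          \<longlonglongrightarrow> (-1) ^ (n + 1) * Re ((deriv ^^ (n + 2)) (normalised_log n Q) (of_real x))"
    using lim unfolding val by (intro tendsto_mult_left)
  moreover have sg: "(-1) ^ (n + 1) * ((-1) ^ (n + 1) * fact (n + 1) * ?S N) = fact (n + 1) * ?S N" for N
    by (simp add: mult.assoc [symmetric] power_add [symmetric] mult_2 [symmetric] del: power_Suc)
  ultimately have "(\<lambda>N. fact (n + 1) * ?S N)
          \<longlonglongrightarrow> (-1) ^ (n + 1) * Re ((deriv ^^ (n + 2)) (normalised_log n Q) (of_real x))"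
    by (simp only: sg)
  thus "(-1) ^ (n + 1) * Re ((deriv ^^ (n + 2)) (normalised_log n Q) (of_real x)) \<ge> 0"
    by (rule LIMSEQ_le_const) (use S0 in auto)
  show "\<bar>Re ((deriv ^^ (n + 2)) (normalised_log n Q) (of_real x))\<bar> \<le> fact (n + 1) / (x - 1)" if "x > 1"
  proof (rule LIMSEQ_le_const2[OF tendsto_rabs[OF lim[unfolded val]]])
    have "\<bar>(-1) ^ (n + 1) * fact (n + 1) * ?S N\<bar> = fact (n + 1) * ?S N" for N
      using S0[of N] by (simp add: abs_mult)
    also have "fact (n + 1) * ?S N \<le> fact (n + 1) * (1 / (x - 1))" for N
      by (intro mult_left_mono sum_choose_over_power_le that) auto
    finally show "\<exists>N0. \<forall>N\<ge>N0. \<bar>(-1) ^ (n + 1) * fact (n + 1) * ?S N\<bar> \<le> fact (n + 1) / (x - 1)"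
      by simp
  qed
qed

text \<open>
  Both sides are entire, so that it suffices to compare them on the positive axis.
\<close>

lemma normalised_product_functional_equation:
  assumes "\<And>x. x > 0 \<Longrightarrow> poly Q' x + real_weierstrass_log (Suc n) x =
       (poly Q x + real_weierstrass_log n x) + (poly Q' (x + 1) + real_weierstrass_log (Suc n) (x + 1))"
  shows "normalised_product (Suc n) Q' z = normalised_product n Q z * normalised_product (Suc n) Q' (z + 1)"
proof -
  let ?f = "\<lambda>z. normalised_product (Suc n) Q' z - normalised_product n Q z * normalised_product (Suc n) Q' (z + 1)"
  have "?f z = 0"
  proof (rule analytic_continuation[where f = ?f and S = UNIV and U = "of_real ` {0<..}" and \<xi> = 1])
    have "(normalised_product (Suc n) Q' \<circ> (\<lambda>z. z + 1)) holomorphic_on UNIV"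
      by (intro holomorphic_on_compose holomorphic_intros normalised_product_holomorphic)
    thus "?f holomorphic_on UNIV"
      by (intro holomorphic_intros normalised_product_holomorphic) (simp add: o_def)
    show "(1::complex) islimpt of_real ` {0<..}" by (rule one_islimpt_positive_reals)
  next
    fix w :: complex assume "w \<in> of_real ` {0<..}"
    then obtain x where x: "w = of_real x" "x > 0" by auto
    have "normalised_product (Suc n) Q' (w + 1) = normalised_product (Suc n) Q' (of_real (x + 1))"
      by (simp add: x)
    thus "?f w = 0" using assms[OF x(2)] x
      by (simp add: normalised_product_of_real exp_add del: of_real_add of_real_exp flip: of_real_mult)
  qed auto
  thus ?thesis by simp
qed

lemma is_pole_one_over_normalised_product_iff:
  "is_pole (\<lambda>z. 1 / normalised_product n Q z) z \<longleftrightarrow> z \<in> \<int>\<^sub>\<le>\<^sub>0"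
proof
  assume z: "z \<in> \<int>\<^sub>\<le>\<^sub>0"
  have hol: "normalised_product n Q holomorphic_on UNIV" by (rule normalised_product_holomorphic)
  have "normalised_product n Q 1 \<noteq> 0" by (simp add: normalised_product_eq_0_iff)
  hence "\<forall>\<^sub>F w in at z. normalised_product n Q w \<noteq> 0"
    using non_zero_neighbour_alt[OF hol] by (auto elim: eventually_mono)
  moreover have "isCont (normalised_product n Q) z"
    using hol by (auto intro: holomorphic_on_imp_continuous_on continuous_on_interior)
  hence "normalised_product n Q \<midarrow>z\<rightarrow> 0"
    using z normalised_product_eq_0_iff[of n Q z] by (simp add: isCont_def)
  ultimately have "filterlim (normalised_product n Q) (at 0) (at z)" by (simp add: filterlim_at)
  thus "is_pole (\<lambda>z. 1 / normalised_product n Q z) z" by (intro is_pole_divide) auto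
next
  assume pole: "is_pole (\<lambda>z. 1 / normalised_product n Q z) z"
  show "z \<in> \<int>\<^sub>\<le>\<^sub>0"
  proof (rule ccontr)
    assume z: "z \<notin> \<int>\<^sub>\<le>\<^sub>0"
    have "(\<lambda>z. 1 / normalised_product n Q z) holomorphic_on - \<int>\<^sub>\<le>\<^sub>0"
      by (intro holomorphic_intros normalised_product_holomorphic) (auto simp: normalised_product_eq_0_iff)
    hence "\<not> is_pole (\<lambda>z. 1 / normalised_product n Q z) z"
      using z by (intro not_is_pole_holomorphic[of "- \<int>\<^sub>\<le>\<^sub>0"]) (auto simp: open_Compl)
    with pole show False by simp
  qed
qed

lemma one_over_normalised_product_nicely_meromorphic:
  "(\<lambda>z. 1 / normalised_product n Q z) nicely_meromorphic_on UNIV"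
proof -
  have hol: "(\<lambda>z. 1 / normalised_product n Q z) holomorphic_on - \<int>\<^sub>\<le>\<^sub>0"
    by (intro holomorphic_intros normalised_product_holomorphic) (auto simp: normalised_product_eq_0_iff)
  have "(\<lambda>z. 1 / normalised_product n Q z) meromorphic_on UNIV"
    by (intro meromorphic_intros analytic_on_imp_meromorphic_on)
       (simp add: analytic_on_open normalised_product_holomorphic)
  moreover have "(\<lambda>z. 1 / normalised_product n Q z) \<midarrow>z\<rightarrow> 1 / normalised_product n Q z" if "z \<notin> \<int>\<^sub>\<le>\<^sub>0" for z
  proof -
    have "isCont (\<lambda>z. 1 / normalised_product n Q z) z"
      using holomorphic_on_imp_continuous_on[OF hol] that
      by (subst (asm) continuous_on_eq_continuous_at) (auto simp: open_Compl)
    thus ?thesis by (simp add: isCont_def)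
  qed
  ultimately show ?thesis unfolding nicely_meromorphic_on_def
    using is_pole_one_over_normalised_product_iff normalised_product_eq_0_iff by auto
qed

lemma is_multiple_Gamma_one_over_normalised_product:
  assumes deg: "degree Q' \<le> n + 2"
    and eq: "\<And>x. x > 0 \<Longrightarrow> poly Q' x + real_weierstrass_log (Suc n) x =
       (poly Q x + real_weierstrass_log n x) + (poly Q' (x + 1) + real_weierstrass_log (Suc n) (x + 1))"
    and one: "poly Q' 1 + real_weierstrass_log (Suc n) 1 = 0"
  shows "is_multiple_Gamma (Suc (Suc n)) (\<lambda>z. 1 / normalised_product n Q z)
           (\<lambda>z. 1 / normalised_product (Suc n) Q' z)"
  unfolding is_multiple_Gamma_def
proof (intro conjI allI impI)
  let ?f = "\<lambda>z. 1 / normalised_product (Suc n) Q' z"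
  show "?f nicely_meromorphic_on UNIV" by (rule one_over_normalised_product_nicely_meromorphic)
  show "is_pole ?f z \<longleftrightarrow> z \<in> \<int>\<^sub>\<le>\<^sub>0" for z by (rule is_pole_one_over_normalised_product_iff)
  show "?f z \<noteq> 0" if "z \<notin> \<int>\<^sub>\<le>\<^sub>0" for z using that by (simp add: normalised_product_eq_0_iff)
  show "?f 1 = 1" using normalised_product_of_real[of 1 "Suc n" Q'] one by simp
  show "?f (z + 1) = ?f z / (1 / normalised_product n Q z)" if "z \<notin> \<int>\<^sub>\<le>\<^sub>0" for z
  proof -
    have "normalised_product n Q z \<noteq> 0" using that by (simp add: normalised_product_eq_0_iff)
    thus ?thesis using normalised_product_functional_equation[OF eq, of z] by simp
  qed
next
  fix x :: real assume x: "x > 0"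
  let ?f = "\<lambda>z. 1 / normalised_product (Suc n) Q' z"
  have val: "?f (of_real t) = of_real (exp (- Re (normalised_log (Suc n) Q' (of_real t))))" if "t > 0" for t
    using that by (rule one_over_normalised_product_of_real)
  show "?f (of_real x) \<in> \<real>" unfolding val[OF x] by simp
  show "Re (?f (of_real x)) > 0" unfolding val[OF x] by (simp del: of_real_exp)
  let ?L = "\<lambda>z. - normalised_log (Suc n) Q' z"
  have hol: "?L holomorphic_on {z. Re z > 0}" by (intro holomorphic_intros normalised_log_holomorphic)
  have "(deriv ^^ (Suc (Suc n) + 1)) (\<lambda>t. ln (Re (?f (of_real t)))) x
          = Re ((deriv ^^ (Suc (Suc n) + 1)) ?L (of_real x))"
    using x val by (intro higher_deriv_Re_of_real(1)[OF hol]) (simp_all del: of_real_exp)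
  also have "(deriv ^^ (Suc (Suc n) + 1)) ?L (of_real x)
          = - (deriv ^^ (Suc n + 2)) (normalised_log (Suc n) Q') (of_real x)"
    using x normalised_log_holomorphic open_halfspace_Re_gt
    by (subst higher_deriv_uminus[where S = "{z. Re z > 0}"]) auto
  finally show "(-1) ^ (Suc (Suc n) + 1) * (deriv ^^ (Suc (Suc n) + 1)) (\<lambda>t. ln (Re (?f (of_real t)))) x \<ge> 0"
    using higher_deriv_normalised_log(1)[of Q' "Suc n" x] deg x by simp
qed

text \<open>
  For \<open>n = 0\<close> the correction is \<open>\<Sum>k. ln k + z / k\<close>, and the product is the Weierstrass product of the
  Gamma function. The zeros are treated separately, because inversion is not continuous there.
\<close>

lemma Gamma_eq_one_over_normalised_product:
  "Gamma z = 1 / normalised_product 0 [:0, euler_mascheroni:] z"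
proof (cases "z \<in> \<int>\<^sub>\<le>\<^sub>0")
  case True
  thus ?thesis using normalised_product_eq_0_iff[of 0 _ z] by (simp add: Gamma_eq_zero_iff)
next
  case False
  let ?Q = "[:0, euler_mascheroni:] :: real poly"
  have Q: "poly (map_poly complex_of_real ?Q) z = euler_mascheroni * z"
    by (simp add: map_poly_pCons mult.commute)
  have taylor: "ln_taylor (Suc 0) w = w" for w :: complex by (simp add: ln_taylor_def)
  have eq: "exp (euler_mascheroni * z) * partial_product 0 (Suc N) z = inverse (Gamma_series_Weierstrass z N)" for N
  proof (induction N)
    case 0
    show ?case by (simp add: partial_product_def Gamma_series_Weierstrass_def
        weierstrass_correction_def exp_minus field_simps)
  next
    case (Suc N)
    let ?k = "of_nat (Suc N) :: complex"
    have k: "?k \<noteq> 0" by (simp del: of_nat_Suc)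
    have "exp (complex_of_real (ln (real (Suc N)))) = ?k" by (simp add: exp_of_real del: of_nat_Suc)
    hence "exp (- (of_real (ln (real (Suc N))) + z / ?k)) = inverse ?k * inverse (exp (z / ?k))"
      by (simp only: minus_add_distrib exp_add exp_minus)
    hence fac: "exp (- (of_real (ln (real (Suc N))) + z / ?k)) * (?k + z) = inverse (exp (z / ?k) / (1 + z / ?k))"
      using k by (simp add: field_simps del: of_nat_Suc)
    have corr: "weierstrass_correction 0 (Suc (Suc N)) z =
        weierstrass_correction 0 (Suc N) z + (of_real (ln (real (Suc N))) + z / ?k)"
      by (simp add: weierstrass_correction_def taylor del: of_nat_Suc)
    have "partial_product 0 (Suc (Suc N)) z = partial_product 0 (Suc N) z *
              (exp (- (of_real (ln (real (Suc N))) + z / ?k)) * (?k + z))"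
      unfolding partial_product_def corr prod.lessThan_Suc[of _ "Suc N"] minus_add_distrib exp_add
      by simp
    hence "exp (euler_mascheroni * z) * partial_product 0 (Suc (Suc N)) z
       = inverse (Gamma_series_Weierstrass z N) * inverse (exp (z / ?k) / (1 + z / ?k))"
      unfolding fac by (simp only: mult.assoc [symmetric] Suc.IH)
    also have "\<dots> = inverse (Gamma_series_Weierstrass z (Suc N))"
      by (simp add: Gamma_series_Weierstrass_def del: of_nat_Suc)
    finally show ?case .
  qed
  have lim: "(\<lambda>N. inverse (Gamma_series_Weierstrass z N)) \<longlonglongrightarrow> inverse (Gamma z)"
    using False by (intro tendsto_inverse Gamma_Weierstrass_complex) (simp add: Gamma_eq_zero_iff)
  have "(\<lambda>N. exp (euler_mascheroni * z) * partial_product 0 (Suc N) z) \<longlonglongrightarrow> normalised_product 0 ?Q z"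
    unfolding normalised_product_def Q by (intro tendsto_intros LIMSEQ_Suc partial_product_tendsto)
  from this[unfolded eq] lim have "normalised_product 0 ?Q z = inverse (Gamma z)"
    by (rule LIMSEQ_unique)
  thus ?thesis by (simp add: inverse_eq_divide)
qed

text \<open>
  Existence and uniqueness together determine the value of the definite description, one index at a
  time: the polynomial for \<open>n + 1\<close> comes from the functional equation, and uniqueness uses the decay
  of the derivative of order \<open>n + 2\<close> of the logarithm for \<open>n\<close>.
\<close>

theorem multiple_Gamma_eq_one_over_normalised_product:
  "\<exists>Q. degree Q \<le> n + 1 \<and> multiple_Gamma (Suc n) = (\<lambda>z. 1 / normalised_product n Q z)"
proof (induction n)
  case 0
  have "multiple_Gamma (Suc 0) = (\<lambda>z. 1 / normalised_product 0 [:0, euler_mascheroni:] z)"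
    using Gamma_eq_one_over_normalised_product by auto
  thus ?case by (intro exI[of _ "[:0, euler_mascheroni:]"]) auto
next
  case (Suc n)
  then obtain Q where Q: "degree Q \<le> n + 1" "multiple_Gamma (Suc n) = (\<lambda>z. 1 / normalised_product n Q z)"
    by blast
  obtain Q' where Q': "degree Q' \<le> n + 2"
    "\<And>x. x > 0 \<Longrightarrow> poly Q' x + real_weierstrass_log (Suc n) x =
       (poly Q x + real_weierstrass_log n x) + (poly Q' (x + 1) + real_weierstrass_log (Suc n) (x + 1))"
    "poly Q' 1 + real_weierstrass_log (Suc n) 1 = 0"
    using next_normalising_polynomial[OF Q(1)] by blast
  let ?g = "\<lambda>z. 1 / normalised_product n Q z" and ?f = "\<lambda>z. 1 / normalised_product (Suc n) Q' z"
  have f: "is_multiple_Gamma (Suc (Suc n)) ?g ?f"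
    by (rule is_multiple_Gamma_one_over_normalised_product[OF Q'])
  have "(THE f. is_multiple_Gamma (Suc (Suc n)) ?g f) = ?f"
  proof (rule the_equality[of "is_multiple_Gamma (Suc (Suc n)) ?g", OF f])
    fix h assume h: "is_multiple_Gamma (Suc (Suc n)) ?g h"
    show "h = ?f"
    proof (rule is_multiple_Gamma_unique[OF h f normalised_log_holomorphic[of n Q]])
      show "?g (of_real x) = of_real (exp (- Re (normalised_log n Q (of_real x))))" if "x > 0" for x
        using that by (rule one_over_normalised_product_of_real)
    next
      fix x :: real assume x: "x > 0"
      show "(\<lambda>N. Re ((deriv ^^ Suc (Suc n)) (normalised_log n Q) (of_real (x + real N)))) \<longlonglongrightarrow> 0"
      proof (rule Lim_null_comparison)
        show "(\<lambda>N. fact (n + 1) / (x + real N - 1)) \<longlonglongrightarrow> 0"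
          by (intro tendsto_divide_0[OF tendsto_const] filterlim_at_top_imp_at_infinity) real_asymp
        show "\<forall>\<^sub>F N in sequentially.
          norm (Re ((deriv ^^ Suc (Suc n)) (normalised_log n Q) (of_real (x + real N)))) \<le> fact (n + 1) / (x + real N - 1)"
          using eventually_ge_at_top[of 1]
        proof eventually_elim
          case (elim N)
          show ?case using higher_deriv_normalised_log(2)[OF Q(1), of "x + real N"] elim x by simp
        qed
      qed
    qed
  qed
  hence "multiple_Gamma (Suc (Suc n)) = ?f" by (simp add: Q(2))
  with Q'(1) show ?case by (intro exI[of _ Q']) simp
qed

section \<open>The infinite product\<close>

lemma polynomial_sum_eq:
  fixes p :: "'a::comm_ring_1 poly"
  assumes "degree p \<le> d" "\<And>j. j \<in> {1..d} \<Longrightarrow> (\<Sum>l\<in>A. a l ^ j) = (\<Sum>l\<in>A. b l ^ j)"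
  shows "(\<Sum>l\<in>A. poly p (a l)) = (\<Sum>l\<in>A. poly p (b l))"
proof -
  have "poly p x = (\<Sum>j\<le>d. coeff p j * x ^ j)" for x
    unfolding poly_altdef using assms(1)
    by (intro sum.mono_neutral_left) (auto simp: coeff_eq_0)
  hence expand: "(\<Sum>l\<in>A. poly p (c l)) = (\<Sum>j\<le>d. coeff p j * (\<Sum>l\<in>A. c l ^ j))" for c
    by (simp add: sum_distrib_left sum.swap[of _ A])
  have "(\<Sum>l\<in>A. a l ^ j) = (\<Sum>l\<in>A. b l ^ j)" if "j \<le> d" for j
    using assms(2)[of j] that by (cases "j = 0") auto
  thus ?thesis unfolding expand by (intro sum.cong) auto
qed

text \<open>
  The exponential of a polynomial of degree at most \<open>n + 1\<close> contributes the same factor for \<open>a\<close> and \<open>b\<close>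
  by the equality of power sums. Inserting such factors turns the plain partial products into quotients of
  normalised partial products, each of which converges.
\<close>

lemma product_formula:
  fixes a b :: "'i \<Rightarrow> complex"
  assumes fin: "finite A"
    and ab: "\<And>l. l \<in> A \<Longrightarrow> a l \<notin> \<int>\<^sub>\<le>\<^sub>0" "\<And>l. l \<in> A \<Longrightarrow> b l \<notin> \<int>\<^sub>\<le>\<^sub>0"
    and eq: "\<And>j. j \<in> {1..n + 1} \<Longrightarrow> (\<Sum>l\<in>A. a l ^ j) = (\<Sum>l\<in>A. b l ^ j)"
  shows "(\<lambda>N. \<Prod>k<N. ((\<Prod>l\<in>A. of_nat k + a l) / (\<Prod>l\<in>A. of_nat k + b l)) ^ ((n + k) choose n))
    \<longlonglongrightarrow> (\<Prod>l\<in>A. multiple_Gamma (n + 1) (b l)) / (\<Prod>l\<in>A. multiple_Gamma (n + 1) (a l))"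
proof -
  obtain Q where Q: "degree Q \<le> n + 1" "multiple_Gamma (Suc n) = (\<lambda>z. 1 / normalised_product n Q z)"
    using multiple_Gamma_eq_one_over_normalised_product by blast
  let ?q = "map_poly complex_of_real Q"
  have q: "degree ?q \<le> n + 1" using Q(1) by (simp add: degree_map_poly)
  let ?X = "\<lambda>N z. exp (poly ?q z) * partial_product n N z"
  have lim: "(\<lambda>N. ?X N z) \<longlonglongrightarrow> normalised_product n Q z" for z
    unfolding normalised_product_def by (intro tendsto_intros partial_product_tendsto)
  have "(\<lambda>N. (\<Prod>l\<in>A. ?X N (a l)) / (\<Prod>l\<in>A. ?X N (b l)))
          \<longlonglongrightarrow> (\<Prod>l\<in>A. normalised_product n Q (a l)) / (\<Prod>l\<in>A. normalised_product n Q (b l))"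
    using ab(2) fin by (intro tendsto_divide tendsto_prod lim) (simp add: normalised_product_eq_0_iff)
  moreover have "(\<Prod>l\<in>A. normalised_product n Q (a l)) / (\<Prod>l\<in>A. normalised_product n Q (b l))
     = (\<Prod>l\<in>A. multiple_Gamma (n + 1) (b l)) / (\<Prod>l\<in>A. multiple_Gamma (n + 1) (a l))"
    by (simp add: Q(2) prod_dividef)
  moreover have "(\<Prod>l\<in>A. ?X N (a l)) / (\<Prod>l\<in>A. ?X N (b l))
    = (\<Prod>k<N. ((\<Prod>l\<in>A. of_nat k + a l) / (\<Prod>l\<in>A. of_nat k + b l)) ^ ((n + k) choose n))" for N
  proof -
    obtain p :: "complex poly" where p: "degree p \<le> n + 1"
      "\<And>z. poly p z = weierstrass_correction n N z" by (rule weierstrass_correction_polynomial) blast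
    have X: "(\<Prod>l\<in>A. ?X N (c l)) = exp (\<Sum>l\<in>A. poly (?q - p) (c l)) *
        (\<Prod>k<N. (\<Prod>l\<in>A. of_nat k + c l) ^ ((n + k) choose n))" for c
    proof -
      have "(\<Prod>l\<in>A. ?X N (c l)) = (\<Prod>l\<in>A. exp (poly (?q - p) (c l)) * (\<Prod>k<N. (of_nat k + c l) ^ ((n + k) choose n)))"
        by (intro prod.cong) (simp_all add: partial_product_def p(2) exp_diff exp_minus divide_inverse)
      also have "\<dots> = exp (\<Sum>l\<in>A. poly (?q - p) (c l)) *
          (\<Prod>l\<in>A. \<Prod>k<N. (of_nat k + c l) ^ ((n + k) choose n))"
        using fin by (simp add: prod.distrib exp_sum)
      also have "(\<Prod>l\<in>A. \<Prod>k<N. (of_nat k + c l) ^ ((n + k) choose n))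
          = (\<Prod>k<N. (\<Prod>l\<in>A. of_nat k + c l) ^ ((n + k) choose n))"
        by (subst prod.swap) (simp add: prod_power_distrib)
      finally show ?thesis .
    qed
    have "degree (?q - p) \<le> n + 1" using q p(1) by (intro degree_diff_le)
    hence "(\<Sum>l\<in>A. poly (?q - p) (a l)) = (\<Sum>l\<in>A. poly (?q - p) (b l))"
      using eq by (rule polynomial_sum_eq)
    thus ?thesis unfolding X by (simp add: power_divide prod_dividef)
  qed
  ultimately show ?thesis by simp
qed

theorem theorem4p2:
  fixes n i :: nat and a b :: "nat \<Rightarrow> complex"
  assumes "i \<ge> 1"
  shows
    "(n \<ge> 1 \<and>
      (\<forall>l\<in>{1..i}. a l \<notin> of_int ` {..<0} \<and> b l \<notin> of_int ` {..<0}) \<and>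
      (\<forall>j\<in>{1..n}. (\<Sum>l=1..i. a l ^ j) = (\<Sum>l=1..i. b l ^ j))
      \<longrightarrow>
      (\<lambda>N. \<Prod>k=1..N.
          ((\<Prod>l=1..i. (of_nat k + a l)) / (\<Prod>l=1..i. (of_nat k + b l)))
            ^ ((n + k - 2) choose (n - 1)))
        \<longlonglongrightarrow> (\<Prod>l=1..i. multiple_Gamma n (b l + 1)) / (\<Prod>l=1..i. multiple_Gamma n (a l + 1)))
     \<and>
     ((\<forall>l\<in>{1..i}. a l \<notin> \<int>\<^sub>\<le>\<^sub>0 \<and> b l \<notin> \<int>\<^sub>\<le>\<^sub>0) \<and>
      (\<forall>j\<in>{1..n+1}. (\<Sum>l=1..i. a l ^ j) = (\<Sum>l=1..i. b l ^ j))
      \<longrightarrow>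
      (\<lambda>N. \<Prod>k=0..N.
          ((\<Prod>l=1..i. (of_nat k + a l)) / (\<Prod>l=1..i. (of_nat k + b l)))
            ^ ((n + k) choose n))
        \<longlonglongrightarrow> (\<Prod>l=1..i. multiple_Gamma (n + 1) (b l)) / (\<Prod>l=1..i. multiple_Gamma (n + 1) (a l)))"
proof (intro conjI impI; elim conjE)
  assume n: "n \<ge> 1" and ab: "\<forall>l\<in>{1..i}. a l \<notin> of_int ` {..<0} \<and> b l \<notin> of_int ` {..<0}"
    and eq: "\<forall>j\<in>{1..n}. (\<Sum>l=1..i. a l ^ j) = (\<Sum>l=1..i. b l ^ j)"
  \<comment> \<open>The first formula is the second one for \<open>m = n - 1\<close> and the shifted sequences \<open>a + 1\<close>, \<open>b + 1\<close>.\<close>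
  obtain m where m: "n = Suc m" using n by (cases n) auto
  have shift: "z + 1 \<notin> \<int>\<^sub>\<le>\<^sub>0" if "z \<notin> of_int ` {..<0}" for z :: complex
  proof
    assume "z + 1 \<in> \<int>\<^sub>\<le>\<^sub>0"
    then obtain k where "z + 1 = of_int k" "k \<le> 0" by (elim nonpos_Ints_cases)
    hence "z = of_int (k - 1)" "k - 1 < 0" by (auto simp: algebra_simps)
    with that show False by blast
  qed
  have "(\<Sum>l=1..i. (a l + 1) ^ j) = (\<Sum>l=1..i. (b l + 1) ^ j)" if "j \<in> {1..m + 1}" for j
  proof -
    \<comment> \<open>The power sums of the shifted sequences are sums of polynomials in the original ones.\<close>
    have "degree ([:1, 1:] ^ j :: complex poly) \<le> n"
      using that m by (simp add: degree_linear_power)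
    hence "(\<Sum>l=1..i. poly ([:1, 1:] ^ j) (a l)) = (\<Sum>l=1..i. poly ([:1, 1:] ^ j) (b l))"
      using eq by (intro polynomial_sum_eq[where d = n]) auto
    thus ?thesis by (simp add: add.commute)
  qed
  hence "(\<lambda>N. \<Prod>k<N. ((\<Prod>l\<in>{1..i}. of_nat k + (a l + 1)) / (\<Prod>l\<in>{1..i}. of_nat k + (b l + 1))) ^ ((m + k) choose m))
    \<longlonglongrightarrow> (\<Prod>l\<in>{1..i}. multiple_Gamma (m + 1) (b l + 1)) / (\<Prod>l\<in>{1..i}. multiple_Gamma (m + 1) (a l + 1))"
    using ab shift by (intro product_formula) auto
  moreover have "(\<Prod>k<N. ((\<Prod>l\<in>{1..i}. of_nat k + (a l + 1)) / (\<Prod>l\<in>{1..i}. of_nat k + (b l + 1))) ^ ((m + k) choose m))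
     = (\<Prod>k=1..N. ((\<Prod>l=1..i. (of_nat k + a l)) / (\<Prod>l=1..i. (of_nat k + b l))) ^ ((n + k - 2) choose (n - 1)))" for N
    by (rule prod.reindex_bij_witness[of _ "\<lambda>k. k - 1" Suc]) (auto simp: m algebra_simps)
  ultimately show "(\<lambda>N. \<Prod>k=1..N. ((\<Prod>l=1..i. (of_nat k + a l)) / (\<Prod>l=1..i. (of_nat k + b l)))
            ^ ((n + k - 2) choose (n - 1)))
        \<longlonglongrightarrow> (\<Prod>l=1..i. multiple_Gamma n (b l + 1)) / (\<Prod>l=1..i. multiple_Gamma n (a l + 1))"
    by (simp add: m)
next
  assume ab: "\<forall>l\<in>{1..i}. a l \<notin> \<int>\<^sub>\<le>\<^sub>0 \<and> b l \<notin> \<int>\<^sub>\<le>\<^sub>0"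
    and eq: "\<forall>j\<in>{1..n+1}. (\<Sum>l=1..i. a l ^ j) = (\<Sum>l=1..i. b l ^ j)"
  have "(\<lambda>N. \<Prod>k<N. ((\<Prod>l\<in>{1..i}. of_nat k + a l) / (\<Prod>l\<in>{1..i}. of_nat k + b l)) ^ ((n + k) choose n))
    \<longlonglongrightarrow> (\<Prod>l\<in>{1..i}. multiple_Gamma (n + 1) (b l)) / (\<Prod>l\<in>{1..i}. multiple_Gamma (n + 1) (a l))"
    using ab eq by (intro product_formula) auto
  from LIMSEQ_Suc[OF this]
  show "(\<lambda>N. \<Prod>k=0..N. ((\<Prod>l=1..i. (of_nat k + a l)) / (\<Prod>l=1..i. (of_nat k + b l)))
            ^ ((n + k) choose n))
        \<longlonglongrightarrow> (\<Prod>l=1..i. multiple_Gamma (n + 1) (b l)) / (\<Prod>l=1..i. multiple_Gamma (n + 1) (a l))"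
    by (simp only: lessThan_Suc_atMost atLeast0AtMost)
qed

end
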